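(* Let $n$ be odd, let $k$ be a positive integer with $\gcd(k,n)=1$, and let $L=GF(2^n)$. Let $f(x)=x^{2^{2k}-2^k+1}$ and $g(x)=x^{2^{4k}-2^{3k}+2^{2k}-2^k+1}$. Let $C$ be the binary code of length $2^n-1$ whose coordinates are indexed by $x\in L^*$ and which consists of all $(c_x)_{x\in L^*}\in GF(2)^{L^*}$ with $$\sum_{x\in L^*} c_x\,x=0,\qquad \sum_{x\in L^*} c_x\,f(x)=0,\qquad \sum_{x\in L^*} c_x\,g(x)=0 .$$ Then $C$ is a triple error correcting code with BCH parameters, i.e. $C$ has parameters $[2^n-1,\,2^n-3n-1,\,7]$ (length $2^n-1$, dimension $2^n-3n-1$, minimum Hamming distance $7$), and its weight distribution equals that of the binary primitive triple error correcting BCH code of length $2^n-1$.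
   Context: $L^*=L\setminus\{0\}$. Equivalently, $C$ is the nullspace of the $3n\times(2^n-1)$ binary matrix whose column indexed by $x\in L^*$ consists of the coordinate vectors (with respect to a fixed basis of $L$ over $GF(2)$) of $x$, $f(x)$ and $g(x)$ stacked on top of each other.
   Formalization: The formal theorem additionally assumes n ≥ 5; for the excluded odd values n = 1 and n = 3 the claimed dimension 2^n − 3n − 1 equals −2, so the statement is false there. *)

theory Defs
  imports Main
begin

text \<open>A binary word indexed by the nonzero elements of a finite field 'a is identified
with its support, a subset of the nonzero elements. Addition of words is symmetric
difference, the Hamming weight is the cardinality of the support.\<close>

definition nonzeros :: "'a::{finite,field} set" where
  "nonzeros = - {0}"

definition power_code :: "nat \<Rightarrow> nat \<Rightarrow> 'a::{finite,field} set set" where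
  "power_code a b = {S. S \<subseteq> nonzeros \<and> (\<Sum>x\<in>S. x) = 0 \<and>
                       (\<Sum>x\<in>S. x ^ a) = 0 \<and> (\<Sum>x\<in>S. x ^ b) = 0}"

text \<open>Binary primitive (narrow-sense) triple error correcting BCH code of length |L|-1:
zeros alpha, alpha^3, alpha^5.\<close>
definition bch3_code :: "'a::{finite,field} set set" where
  "bch3_code = power_code 3 5"

definition hamming_dist :: "'a set \<Rightarrow> 'a set \<Rightarrow> nat" where
  "hamming_dist S T = card ((S - T) \<union> (T - S))"

definition code_length :: "'a::{finite,field} set set \<Rightarrow> nat" where
  "code_length C = card (nonzeros :: 'a set)"

definition binary_dim :: "'a set set \<Rightarrow> nat" where
  "binary_dim C = (THE d. card C = 2 ^ d)"

definition min_distance :: "'a set set \<Rightarrow> nat" where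
  "min_distance C = Min {hamming_dist S T | S T. S \<in> C \<and> T \<in> C \<and> S \<noteq> T}"

definition weight_distribution :: "'a set set \<Rightarrow> nat \<Rightarrow> nat" where
  "weight_distribution C w = card {S \<in> C. card S = w}"

end

theory Submission
  imports Defs "HOL-Computational_Algebra.Polynomial" "HOL-Computational_Algebra.Primes"
begin

text \<open>
  Put \<open>q = 2 ^ k\<close>. Since \<open>y \<mapsto> y ^ (q + 1)\<close> permutes the field, the three parity checks become
  the vanishing of the power sums with the quadratic exponents \<open>q + 1\<close>, \<open>q ^ 3 + 1\<close>, \<open>q ^ 5 + 1\<close>.
  The character sum attached to a word of the dual code is then a quadratic Gauss sum whose radical
  is the kernel of a linearized polynomial of degree 5 in \<open>x \<mapsto> x ^ (q ^ 2)\<close>, hence of dimension at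
  most 5; as \<open>n\<close> is odd, the sum is 0 or \<open>\<plusminus> 2 ^ ((n + d) div 2)\<close> with \<open>d \<in> {1, 3, 5}\<close>. The dual
  of the BCH code takes values in the same set of seven numbers.

  Both codes have minimum distance at least 7: for the BCH code by the Vandermonde argument, for the
  other one by pairing \<open>y ^ (q ^ 5)\<close> with linearized polynomials that vanish on prescribed
  hyperplanes. Hence a zero-sum tuple of length at most 6 is one in which every nonzero element
  occurs an even number of times, so the moments of order 0 to 6 of the character sums agree for the
  two codes. Seven moments determine a distribution on seven values, and by MacWilliams the weight
  distributions agree. The value \<open>2 ^ n\<close>, which may belong to the seven numbers when \<open>n = 5\<close>, is
  excluded through the BCH code, where the radical has dimension at most 4; this gives the dimension.
\<close>

text \<open>Vandermonde argument: \<open>p\<close> vanishes on \<open>W\<close> except at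
  \<open>w\<close> and has degree below \<open>card W\<close>, so pairing \<delta> with
  \<open>p\<close> isolates \<open>w\<close>. It serves for moments over the integers and for power
  sums in the field.\<close>

lemma power_sums_eq_0_imp_eq_0:
  fixes \<delta> :: "'b::idom \<Rightarrow> 'b"
  assumes "finite W" and "\<And>j. j < card W \<Longrightarrow> (\<Sum>v\<in>W. \<delta> v * v ^ j) = 0" and "w \<in> W"
  shows "\<delta> w = 0"
proof -
  define p where "p = (\<Prod>u\<in>W - {w}. [:- u, 1:])"
  have "degree p \<le> (\<Sum>u\<in>W - {w}. degree [:- u, 1:])"
    unfolding p_def using degree_prod_sum_le[of "W - {w}" "\<lambda>u. [:- u, 1:]"] assms(1) by (simp add: o_def)
  also have "\<dots> < card W"
    using card_Diff1_less[OF assms(1,3)] by simp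
  finally have deg: "degree p < card W" .
  have "(\<Sum>v\<in>W. \<delta> v * poly p v) = (\<Sum>v\<in>W. \<Sum>j\<le>degree p. coeff p j * (\<delta> v * v ^ j))"
    by (simp add: poly_altdef sum_distrib_left mult_ac)
  also have "\<dots> = (\<Sum>j\<le>degree p. coeff p j * (\<Sum>v\<in>W. \<delta> v * v ^ j))"
    by (subst sum.swap) (simp add: sum_distrib_left)
  also have "\<dots> = 0"
    using deg by (intro sum.neutral) (auto simp: assms(2))
  finally have "(\<Sum>v\<in>W. \<delta> v * poly p v) = 0" .
  moreover have "(\<Sum>v\<in>W. \<delta> v * poly p v) = (\<Sum>v\<in>{w}. \<delta> v * poly p v)"
    using assms(1,3) by (intro sum.mono_neutral_right) (auto simp: p_def poly_prod)
  moreover have "poly p w \<noteq> 0"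
    using assms(1) by (auto simp: p_def poly_prod)
  ultimately show ?thesis
    by simp
qed

section \<open>Arithmetic in a field with 2^n elements, n odd\<close>

locale odd_binary_field =
  fixes n :: nat and F :: "'a::{finite,field} itself"
  assumes odd_n: "odd n" and card_field: "card (UNIV :: 'a set) = 2 ^ n"
begin

lemma power_card_eq [simp]: "(x::'a) ^ (2 ^ n) = x"
proof (cases "x = 0")
  case False
  have "x * (\<Prod>y\<in>UNIV-{0}. x * y) = x * x ^ (card (UNIV :: 'a set) - 1) * \<Prod>(UNIV-{0})"
    by (simp add: prod.distrib mult_ac)
  also have "x * x ^ (card (UNIV :: 'a set) - 1) = x ^ 2 ^ n"
    by (simp add: card_field flip: power_Suc)
  also have "(\<Prod>y\<in>UNIV-{0}. x * y) = (\<Prod>y\<in>UNIV-{0}. y)"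
    by (rule prod.reindex_bij_witness[of _ "\<lambda>y. y / x" "\<lambda>y. x * y"]) (use False in auto)
  finally show ?thesis
    by simp
qed auto

text \<open>(-1)^(2^n) is -1, like any element raised to that power, and 1, because the exponent is
  even.\<close>

lemma add_self [simp]: "(x::'a) + x = 0"
proof -
  have "even ((2::nat) ^ n)"
    using odd_n by (auto intro: Nat.gr0I)
  hence "(-1::'a) ^ (2 ^ n) = 1"
    by (simp only: power_minus_even power_one)
  hence "(1::'a) = -1"
    unfolding power_card_eq by (rule sym)
  hence "(1::'a) + 1 = 1 + (-1)"
    by (rule arg_cong)
  hence "(1::'a) + 1 = 0"
    by (simp only: add.right_inverse)
  thus ?thesis
    by (metis distrib_left mult.right_neutral mult_zero_right)
qed

lemma add_self_left [simp]: "(x::'a) + (x + y) = y"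
  by (simp flip: add.assoc)

lemma minus_eq [simp]: "- (x::'a) = x"
  by (rule minus_unique) simp

lemma diff_eq [simp]: "(x::'a) - y = x + y"
  by (simp only: diff_conv_add_uminus minus_eq)

lemma add_eq_0_iff [simp]: "(x::'a) + y = 0 \<longleftrightarrow> x = y"
  by (metis diff_eq right_minus_eq)

lemma add_eq_iff_eq_add: "(x::'a) + y = z \<longleftrightarrow> x = y + z"
proof
  assume "x + y = z"
  hence "y + (y + x) = y + z"
    by (simp only: add.commute)
  thus "x = y + z"
    by simp
qed (simp add: add.assoc add.commute[of y])

lemma frobenius_add: "((x::'a) + y) ^ (2 ^ m) = x ^ (2 ^ m) + y ^ (2 ^ m)"
proof (induction m)
  case (Suc m)
  have "((x + y) ^ (2 ^ m)) ^ 2 = (x ^ (2 ^ m)) ^ 2 + (y ^ (2 ^ m)) ^ 2"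
    unfolding Suc.IH by (simp add: power2_eq_square algebra_simps)
  thus ?case
    by (simp add: mult.commute flip: power_mult)
qed simp

lemma frobenius_sum: "(\<Sum>i\<in>A. f i :: 'a) ^ (2 ^ m) = (\<Sum>i\<in>A. f i ^ (2 ^ m))"
  by (induction A rule: infinite_finite_induct) (simp_all add: frobenius_add power_0_left)

lemma frobenius_inj: "(x::'a) ^ (2 ^ m) = y ^ (2 ^ m) \<longleftrightarrow> x = y"
proof
  assume "x ^ (2 ^ m) = y ^ (2 ^ m)"
  hence "(x + y) ^ (2 ^ m) = 0"
    by (simp add: frobenius_add)
  thus "x = y"
    by simp
qed auto

text \<open>Bezout gives \<open>m * a = n * b + 1\<close>; iterating both maps that fix
  \<open>x\<close> yields x^2 = x.\<close>

lemma frobenius_fixed: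
  assumes "coprime m n" and "(x::'a) ^ (2 ^ m) = x"
  shows "x = 0 \<or> x = 1"
proof -
  have "n > 0" using odd_n by (auto intro: Nat.gr0I)
  have iter: "y ^ (2 ^ (i * j)) = y" if "y ^ (2 ^ i) = y" for y :: 'a and i j
    by (induction j) (use that in \<open>simp_all add: power_add power_mult\<close>)
  have "x ^ 2 = x"
  proof (cases "m = 0")
    case True
    hence "n = 1" using assms by simp
    thus ?thesis using power_card_eq[of x] by simp
  next
    case False
    obtain a b where "m * a = n * b + 1"
      using bezout_nat[OF False, of n] assms(1) by (auto simp: mult.commute)
    hence "x ^ 2 ^ (m * a) = (x ^ 2 ^ (n * b)) ^ 2"
      by (simp add: mult.commute flip: power_mult)
    thus ?thesis
      using iter[of x m a] iter[of x n b] assms(2) by simp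
  qed
  thus ?thesis
    by (simp add: power2_eq_square)
qed

subsection \<open>The additive character\<close>

text \<open>The absolute trace to GF(2), kept inside the field; \<open>chi\<close> is the canonical
  additive character.\<close>

definition tr :: "'a \<Rightarrow> 'a" where
  "tr x = (\<Sum>i<n. x ^ (2 ^ i))"

definition chi :: "'a \<Rightarrow> int" where
  "chi x = (if tr x = 0 then 1 else -1)"

lemma tr_add: "tr (x + y) = tr x + tr y"
  by (simp add: tr_def frobenius_add sum.distrib)

lemma tr_square: "tr (x\<^sup>2) = tr x" "(tr x)\<^sup>2 = tr x"
proof -
  have "tr (x\<^sup>2) + x = (\<Sum>i<Suc n. x ^ (2 ^ i))"
    unfolding tr_def by (subst sum.lessThan_Suc_shift) (simp add: add.commute flip: power_mult)
  hence "tr (x\<^sup>2) + x = tr x + x"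
    by (simp add: tr_def)
  thus 1: "tr (x\<^sup>2) = tr x"
    by simp
  have "(tr x)\<^sup>2 = tr (x\<^sup>2)"
    using frobenius_sum[of "\<lambda>i. x ^ (2 ^ i)" "{..<n}" 1]
    by (simp add: tr_def mult.commute flip: power_mult)
  thus "(tr x)\<^sup>2 = tr x"
    using 1 by simp
qed

lemma tr_cases: "tr x = 0 \<or> tr x = 1"
  using tr_square(2)[of x] by (simp add: power2_eq_square)

lemma tr_one: "tr 1 = 1"
proof -
  have "(\<Sum>i<2 * m + 1. 1 :: 'a) = 1" for m :: nat
    by (induction m) (simp_all add: add.assoc)
  then show ?thesis
    using odd_n by (auto simp: tr_def elim!: oddE)
qed

lemma chi_0 [simp]: "chi 0 = 1"
  by (simp add: chi_def tr_def power_0_left)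

lemma chi_add: "chi (x + y) = chi x * chi y"
  using tr_cases[of x] tr_cases[of y] by (auto simp: chi_def tr_add)

lemma chi_sum: "chi (\<Sum>i\<in>A. f i) = (\<Prod>i\<in>A. chi (f i))"
  by (induction A rule: infinite_finite_induct) (simp_all add: chi_add)

lemma chi_cases: "chi x = 1 \<or> chi x = -1"
  by (simp add: chi_def)

lemma chi_square [simp]: "chi x * chi x = 1"
  using chi_cases[of x] by auto

lemma chi_frobenius: "chi (x ^ (2 ^ m)) = chi x"
proof (induction m)
  case (Suc m)
  have "chi ((x ^ (2 ^ m))\<^sup>2) = chi x"
    using Suc.IH by (simp only: chi_def tr_square)
  thus ?case
    by (simp add: mult.commute flip: power_mult)
qed simp

text \<open>Shifting x by 1/a multiplies the sum by \<open>chi 1\<close>, which is -1 because n is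
  odd.\<close>

lemma chi_orthogonal: "(\<Sum>x\<in>UNIV. chi (x * a)) = (if a = 0 then 2 ^ n else 0)"
proof (cases "a = 0")
  case False
  let ?S = "\<Sum>x\<in>UNIV. chi (x * a)"
  have "?S = (\<Sum>x\<in>UNIV. chi ((x + 1 / a) * a))"
    by (rule sum.reindex_bij_witness[of _ "\<lambda>x. x + 1 / a" "\<lambda>x. x + 1 / a"])
      (auto simp: add.assoc)
  also have "\<dots> = (\<Sum>x\<in>UNIV. chi (x * a) * chi 1)"
    using False by (simp add: distrib_right chi_add)
  also have "\<dots> = - ?S"
    by (simp add: chi_def[of 1] tr_one sum_negf)
  finally show ?thesis
    using False by simp
qed (simp add: card_field)

lemma chi_orthogonal3:
  "(\<Sum>t\<in>UNIV. chi (fst t * u + fst (snd t) * v + snd (snd t) * w)) =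
     (if u = 0 \<and> v = 0 \<and> w = 0 then 2 ^ (3 * n) else 0)"
proof -
  have "(\<Sum>t\<in>UNIV. chi (fst t * u + fst (snd t) * v + snd (snd t) * w)) =
        (\<Sum>a\<in>UNIV. chi (a * u)) * ((\<Sum>b\<in>UNIV. chi (b * v)) * (\<Sum>c\<in>UNIV. chi (c * w)))"
    unfolding sum_product sum.cartesian_product UNIV_Times_UNIV
    by (simp add: case_prod_unfold chi_add sum_product sum.cartesian_product
        sum_distrib_left mult.assoc flip: UNIV_Times_UNIV)
  also have "\<dots> = (if u = 0 \<and> v = 0 \<and> w = 0 then 2 ^ (3 * n) else 0)"
    by (simp add: chi_orthogonal flip: power_add)
  finally show ?thesis .
qed

end

subsection \<open>Moments and weights\<close>

text \<open>Arbitrary functions in place of powers let both codes share the counting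
  arguments.\<close>

definition fun_code :: "('a::{finite,field} \<Rightarrow> 'a) \<Rightarrow> ('a \<Rightarrow> 'a) \<Rightarrow> 'a set set" where
  "fun_code f g = {S. S \<subseteq> nonzeros \<and> (\<Sum>x\<in>S. x) = 0 \<and> (\<Sum>x\<in>S. f x) = 0 \<and> (\<Sum>x\<in>S. g x) = 0}"

lemma power_code_eq_fun_code: "power_code a b = fun_code (\<lambda>x. x ^ a) (\<lambda>x. x ^ b)"
  by (simp add: power_code_def fun_code_def)

lemma power_sum_eq_sum_lists:
  fixes h :: "'b::finite \<Rightarrow> 'c::comm_semiring_1"
  shows "(\<Sum>x\<in>UNIV. h x) ^ j = (\<Sum>xs | length xs = j. prod_list (map h xs))"
proof (induction j)
  case (Suc j)
  have "{xs::'b list. length xs = Suc j} = (\<lambda>(x, xs). x # xs) ` (UNIV \<times> {xs. length xs = j})"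
    by (auto simp: length_Suc_conv image_iff)
  moreover have "inj_on (\<lambda>(x, xs). x # xs) (UNIV \<times> {xs::'b list. length xs = j})"
    by (auto simp: inj_on_def)
  ultimately have "(\<Sum>xs | length xs = Suc j. prod_list (map h xs)) =
      (\<Sum>(x, xs)\<in>UNIV \<times> {xs. length xs = j}. h x * prod_list (map h xs))"
    by (simp add: sum.reindex case_prod_unfold)
  also have "\<dots> = (\<Sum>x\<in>UNIV. h x) ^ Suc j"
    by (simp add: Suc.IH sum_product flip: sum.cartesian_product)
  finally show ?case
    by simp
qed simp

lemma coeff_prod_linear:
  fixes y :: "'b \<Rightarrow> 'c::comm_ring_1"
  assumes "finite A"
  shows "coeff (\<Prod>x\<in>A. [:1, y x:]) w = (\<Sum>S | S \<subseteq> A \<and> card S = w. \<Prod>x\<in>S. y x)"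
proof -
  have monom: "(\<Prod>x\<in>S. monom (y x) 1) = monom (\<Prod>x\<in>S. y x) (card S)" for S
    by (induction S rule: infinite_finite_induct) (simp_all add: mult_monom)
  note monom = monom[unfolded One_nat_def]
  have "(\<Prod>x\<in>A. [:1, y x:]) = (\<Prod>x\<in>A. monom (y x) 1 + 1)"
    by (simp add: monom_altdef one_pCons)
  also have "\<dots> = (\<Sum>S\<in>Pow A. monom (\<Prod>x\<in>S. y x) (card S))"
    using assms by (simp add: prod_add monom)
  finally have "coeff (\<Prod>x\<in>A. [:1, y x:]) w = (\<Sum>S\<in>Pow A. if card S = w then \<Prod>x\<in>S. y x else 0)"
    by (simp add: coeff_sum)
  also have "\<dots> = (\<Sum>S\<in>{S \<in> Pow A. card S = w}. \<Prod>x\<in>S. y x)"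
    using assms by (subst sum.inter_filter) auto
  finally show ?thesis
    by (simp add: Pow_def)
qed

lemma sum_comp_eq_sum_card_fibres:
  fixes u :: "'b \<Rightarrow> 'c" and h :: "'c \<Rightarrow> int"
  assumes "finite T" "finite W" "u ` T \<subseteq> W"
  shows "(\<Sum>t\<in>T. h (u t)) = (\<Sum>v\<in>W. int (card {t \<in> T. u t = v}) * h v)"
proof -
  have "(\<Sum>t\<in>T. h (u t)) = (\<Sum>v\<in>W. \<Sum>t | t \<in> T \<and> u t = v. h (u t))"
    using assms by (rule sum.group[symmetric])
  also have "\<dots> = (\<Sum>v\<in>W. int (card {t \<in> T. u t = v}) * h v)"
    by (intro sum.cong) (auto simp: mult.commute)
  finally show ?thesis .
qed

context odd_binary_field
begin

text \<open>The dual word belonging to the triple \<open>t\<close>, written with signs. If f and g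
  vanish at 0, summing over the whole field makes \<open>wsum\<close> equal to 2^n minus twice the
  weight of that word.\<close>

definition phase :: "('a \<Rightarrow> 'a) \<Rightarrow> ('a \<Rightarrow> 'a) \<Rightarrow> 'a \<times> 'a \<times> 'a \<Rightarrow> 'a \<Rightarrow> int" where
  "phase f g t x = chi (fst t * x + fst (snd t) * f x + snd (snd t) * g x)"

definition wsum :: "('a \<Rightarrow> 'a) \<Rightarrow> ('a \<Rightarrow> 'a) \<Rightarrow> 'a \<times> 'a \<times> 'a \<Rightarrow> int" where
  "wsum f g t = (\<Sum>x\<in>UNIV. phase f g t x)"

lemma phase_cases: "phase f g t x = 1 \<or> phase f g t x = -1"
  unfolding phase_def by (rule chi_cases)

lemma wsum_0: "wsum f g (0, 0, 0) = 2 ^ n"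
  by (simp add: wsum_def phase_def card_field)

lemma sum_prod_phase:
  "(\<Sum>t\<in>UNIV. \<Prod>x\<in>S. phase f g t x) =
     (if (\<Sum>x\<in>S. x) = 0 \<and> (\<Sum>x\<in>S. f x) = 0 \<and> (\<Sum>x\<in>S. g x) = 0 then 2 ^ (3 * n) else 0)"
proof -
  have "(\<Prod>x\<in>S. phase f g t x) =
      chi (fst t * (\<Sum>x\<in>S. x) + fst (snd t) * (\<Sum>x\<in>S. f x) + snd (snd t) * (\<Sum>x\<in>S. g x))" for t
    unfolding phase_def chi_sum[symmetric] by (simp add: sum.distrib sum_distrib_left)
  thus ?thesis
    by (simp only: chi_orthogonal3)
qed

lemma sum_prod_list_phase:
  "(\<Sum>t\<in>UNIV. prod_list (map (phase f g t) xs)) =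
     (if sum_list xs = 0 \<and> sum_list (map f xs) = 0 \<and> sum_list (map g xs) = 0 then 2 ^ (3 * n) else 0)"
proof -
  have "prod_list (map (phase f g t) xs) =
      chi (fst t * sum_list xs + fst (snd t) * sum_list (map f xs) + snd (snd t) * sum_list (map g xs))" for t
    by (induction xs) (simp_all add: phase_def distrib_left add_ac flip: chi_add)
  thus ?thesis
    by (simp only: chi_orthogonal3)
qed

text \<open>After expanding the power and summing over \<open>t\<close> first, orthogonality keeps
  exactly the lists that satisfy the three checks.\<close>

lemma moment_wsum:
  "(\<Sum>t\<in>UNIV. wsum f g t ^ j) = 2 ^ (3 * n) * int (card {xs. length xs = j \<and>
      sum_list xs = 0 \<and> sum_list (map f xs) = 0 \<and> sum_list (map g xs) = 0})"
proof -
  have fin: "finite {xs::'a list. length xs = j}"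
    using finite_lists_length_eq[of "UNIV :: 'a set" j] by simp
  have "(\<Sum>t\<in>UNIV. wsum f g t ^ j) =
      (\<Sum>xs | length xs = j. \<Sum>t\<in>UNIV. prod_list (map (phase f g t) xs))"
    unfolding wsum_def power_sum_eq_sum_lists by (rule sum.swap)
  also have "\<dots> = (\<Sum>xs\<in>{xs \<in> {xs. length xs = j}. sum_list xs = 0 \<and> sum_list (map f xs) = 0 \<and>
      sum_list (map g xs) = 0}. 2 ^ (3 * n))"
    unfolding sum_prod_list_phase sum.inter_filter[OF fin] ..
  finally show ?thesis
    by (simp add: mult.commute)
qed

text \<open>Equal entries cancel in pairs in characteristic 2, and entries 0 contribute
  nothing.\<close>

lemma sum_list_eq_sum_odd_count:
  fixes h :: "'a \<Rightarrow> 'a"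
  assumes "h 0 = 0"
  shows "sum_list (map h xs) = (\<Sum>x | x \<noteq> 0 \<and> odd (count_list xs x). h x)"
proof (induction xs)
  case (Cons y ys)
  let ?O = "\<lambda>xs. {x. x \<noteq> 0 \<and> odd (count_list xs x)}"
  have "h y + (\<Sum>x\<in>?O ys. h x) = (\<Sum>x\<in>?O (y # ys). h x)"
  proof (cases "y = 0")
    case True
    hence "?O (y # ys) = ?O ys" by auto
    thus ?thesis using True assms by simp
  next
    case False
    show ?thesis
    proof (cases "y \<in> ?O ys")
      case True
      hence "?O ys = insert y (?O (y # ys))" "y \<notin> ?O (y # ys)" by auto
      thus ?thesis by simp
    next
      case F: False
      hence "?O (y # ys) = insert y (?O ys)" using False by auto
      thus ?thesis using F by simp
    qed
  qed
  thus ?case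
    by (simp only: list.map sum_list.Cons Cons.IH)
qed simp

text \<open>The nonzero elements of odd multiplicity number at most 6, so they form a codeword only
  if there are none. The right-hand side no longer depends on f and g, hence neither do the moments
  of order at most 6.\<close>

lemma zero_sum_lists:
  fixes f g :: "'a \<Rightarrow> 'a"
  assumes "f 0 = 0" "g 0 = 0" and dist: "\<And>S. S \<in> fun_code f g \<Longrightarrow> S \<noteq> {} \<Longrightarrow> 7 \<le> card S"
    and "j \<le> 6"
  shows "{xs. length xs = j \<and> sum_list xs = 0 \<and> sum_list (map f xs) = 0 \<and> sum_list (map g xs) = 0} =
    {xs. length xs = j \<and> (\<forall>x. x \<noteq> 0 \<longrightarrow> even (count_list xs x))}"
proof (intro Collect_cong conj_cong refl)
  fix xs :: "'a list" assume len: "length xs = j"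
  let ?O = "{x. x \<noteq> 0 \<and> odd (count_list xs x)}"
  have "?O \<subseteq> set xs"
    by (auto intro: ccontr simp: count_list_0_iff)
  hence "card ?O \<le> card (set xs)"
    by (intro card_mono) auto
  also have "\<dots> \<le> 6"
    using card_length[of xs] len \<open>j \<le> 6\<close> by linarith
  finally have "\<not> 7 \<le> card ?O"
    by linarith
  have "?O \<in> fun_code f g \<longleftrightarrow> ?O = {}"
  proof
    assume "?O \<in> fun_code f g"
    thus "?O = {}"
      using dist[of ?O] \<open>\<not> 7 \<le> card ?O\<close> by argo
  next
    assume "?O = {}"
    thus "?O \<in> fun_code f g"
      by (simp only: fun_code_def) simp
  qed
  moreover have "?O \<in> fun_code f g \<longleftrightarrow>
      sum_list xs = 0 \<and> sum_list (map f xs) = 0 \<and> sum_list (map g xs) = 0"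
  proof -
    have "sum_list xs = (\<Sum>x\<in>?O. x)" "sum_list (map f xs) = (\<Sum>x\<in>?O. f x)"
        "sum_list (map g xs) = (\<Sum>x\<in>?O. g x)"
      using sum_list_eq_sum_odd_count[of "\<lambda>x. x" xs] sum_list_eq_sum_odd_count[of f xs]
        sum_list_eq_sum_odd_count[of g xs] assms(1,2) by simp_all
    moreover have "?O \<subseteq> nonzeros"
      by (auto simp: nonzeros_def)
    ultimately show ?thesis
      by (simp only: fun_code_def mem_Collect_eq simp_thms)
  qed
  ultimately show "(sum_list xs = 0 \<and> sum_list (map f xs) = 0 \<and> sum_list (map g xs) = 0) \<longleftrightarrow>
      (\<forall>x. x \<noteq> 0 \<longrightarrow> even (count_list xs x))"
    by (simp only: Collect_empty_eq) blast
qed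

text \<open>The difference \<delta> of the two multiplicity functions lives on at most seven values
  and has vanishing moments of order 0 to 6, so the Vandermonde lemma kills it.\<close>

lemma wsum_distribution_eq:
  assumes "f 0 = 0" "g 0 = 0" "f' 0 = 0" "g' 0 = 0"
    and dist: "\<And>S. S \<in> fun_code f g \<Longrightarrow> S \<noteq> {} \<Longrightarrow> 7 \<le> card S"
    and dist': "\<And>S. S \<in> fun_code f' g' \<Longrightarrow> S \<noteq> {} \<Longrightarrow> 7 \<le> card S"
    and W: "finite W" "card W \<le> 7"
    and wsum_W: "\<And>t. t \<noteq> (0, 0, 0) \<Longrightarrow> wsum f g t \<in> W"
    and wsum'_W: "\<And>t. t \<noteq> (0, 0, 0) \<Longrightarrow> wsum f' g' t \<in> W"
  shows "card {t. wsum f g t = v} = card {t. wsum f' g' t = v}"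
proof -
  \<comment> \<open>The zero triple is set apart because its value 2^n need not lie in
    \<open>W\<close>.\<close>
  let ?T = "- {(0, 0, 0)} :: ('a \<times> 'a \<times> 'a) set"
  define \<delta> where "\<delta> v = int (card {t \<in> ?T. wsum f g t = v}) - int (card {t \<in> ?T. wsum f' g' t = v})" for v
  have "\<delta> v = 0" if "v \<in> W" for v
  proof (rule power_sums_eq_0_imp_eq_0[OF W(1) _ that])
    fix j assume "j < card W"
    hence j: "j \<le> 6" using W(2) by simp
    have "(\<Sum>v\<in>W. \<delta> v * v ^ j) = (\<Sum>t\<in>?T. wsum f g t ^ j) - (\<Sum>t\<in>?T. wsum f' g' t ^ j)"
    proof -
      have "wsum f g ` ?T \<subseteq> W" "wsum f' g' ` ?T \<subseteq> W"
        using wsum_W wsum'_W by blast+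
      thus ?thesis
        using sum_comp_eq_sum_card_fibres[of ?T W "wsum f g" "\<lambda>v. v ^ j"] W(1)
          sum_comp_eq_sum_card_fibres[of ?T W "wsum f' g'" "\<lambda>v. v ^ j"]
        unfolding \<delta>_def left_diff_distrib sum_subtractf by simp
    qed
    also have "\<dots> = (\<Sum>t\<in>UNIV. wsum f g t ^ j) - (\<Sum>t\<in>UNIV. wsum f' g' t ^ j)"
      by (simp add: sum.remove[of UNIV "(0, 0, 0)"] Compl_eq_Diff_UNIV wsum_0)
    also have "\<dots> = 0"
      unfolding moment_wsum using assms(1-4) j
      by (simp add: zero_sum_lists[OF _ _ dist] zero_sum_lists[OF _ _ dist'])
    finally show "(\<Sum>v\<in>W. \<delta> v * v ^ j) = 0" .
  qed
  moreover have "\<delta> v = 0" if "v \<notin> W" for v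
  proof -
    have "{t \<in> ?T. wsum f g t = v} = {}" "{t \<in> ?T. wsum f' g' t = v} = {}"
      using that wsum_W wsum'_W by blast+
    thus ?thesis unfolding \<delta>_def by (simp only: card.empty)
  qed
  ultimately have "\<delta> v = 0"
    by blast
  moreover have "card {t. wsum f g t = v} = card {t \<in> ?T. wsum f g t = v} + (if v = 2 ^ n then 1 else 0)"
    for f g
  proof -
    have "{t. wsum f g t = v} =
        {t \<in> ?T. wsum f g t = v} \<union> (if v = 2 ^ n then {(0, 0, 0)} else {})"
      using wsum_0[of f g] by auto
    thus ?thesis
      by (auto simp: card_insert_if)
  qed
  ultimately show ?thesis
    by (simp add: \<delta>_def)
qed

text \<open>The Krawtchouk polynomial for length 2^n - 1 in terms of the character sum
  \<open>s\<close>: the two exponents are the numbers of signs 1 and -1 on the nonzero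
  elements.\<close>

definition krawtchouk :: "nat \<Rightarrow> int \<Rightarrow> int" where
  "krawtchouk w s = coeff ([:1, 1:] ^ nat ((s + 2 ^ n - 2) div 2) * [:1, -1:] ^ nat ((2 ^ n - s) div 2)) w"

lemma sum_prod_phase_eq_krawtchouk:
  "(\<Sum>S | S \<subseteq> nonzeros \<and> card S = w. \<Prod>x\<in>S. phase f g t x) = krawtchouk w (wsum f g t)"
  if "f 0 = 0" "g 0 = 0"
proof -
  let ?P = "{x \<in> nonzeros. phase f g t x = 1}" and ?M = "{x \<in> nonzeros. phase f g t x = -1}"
  have split: "nonzeros = ?P \<union> ?M" "?P \<inter> ?M = {}"
    using phase_cases[of f g t] by auto
  have "int (card ?P) + int (card ?M) = int (card (nonzeros :: 'a set))"
    using card_Un_disjoint[OF _ _ split(2)] by (simp add: split(1)[symmetric])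
  also have "\<dots> = 2 ^ n - 1"
    by (simp add: nonzeros_def card_field Compl_eq_Diff_UNIV of_nat_diff)
  finally have sum: "int (card ?P) + int (card ?M) = 2 ^ n - 1" .
  have "wsum f g t = 1 + (\<Sum>x\<in>nonzeros. phase f g t x)"
    using that by (simp add: wsum_def sum.remove[of UNIV 0] phase_def nonzeros_def Compl_eq_Diff_UNIV)
  also have "(\<Sum>x\<in>nonzeros. phase f g t x) = (\<Sum>x\<in>?P. phase f g t x) + (\<Sum>x\<in>?M. phase f g t x)"
    using sum.union_disjoint[OF _ _ split(2), of "phase f g t"] by (simp add: split(1)[symmetric])
  also have "\<dots> = int (card ?P) - int (card ?M)"
    by simp
  finally have diff: "wsum f g t = 1 + int (card ?P) - int (card ?M)" by simp
  have "wsum f g t + 2 ^ n - 2 = 2 * int (card ?P)" "2 ^ n - wsum f g t = 2 * int (card ?M)"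
    using sum diff by linarith+
  hence cards: "nat ((wsum f g t + 2 ^ n - 2) div 2) = card ?P" "nat ((2 ^ n - wsum f g t) div 2) = card ?M"
    by simp_all
  have "(\<Prod>x\<in>nonzeros. [:1, phase f g t x:]) =
      (\<Prod>x\<in>?P. [:1, phase f g t x:]) * (\<Prod>x\<in>?M. [:1, phase f g t x:])"
    using prod.union_disjoint[OF _ _ split(2), of "\<lambda>x. [:1, phase f g t x:]"] by (simp add: split(1)[symmetric])
  also have "\<dots> = [:1, 1:] ^ card ?P * [:1, -1:] ^ card ?M"
    by simp
  finally show ?thesis
    by (simp add: coeff_prod_linear[symmetric] krawtchouk_def cards)
qed

text \<open>Double count over supports of size \<open>w\<close> and triples: orthogonality evaluates
  one order of summation, Krawtchouk values the other.\<close>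

lemma macwilliams_identity:
  assumes "f 0 = 0" "g 0 = 0"
  shows "2 ^ (3 * n) * int (weight_distribution (fun_code f g) w) = (\<Sum>t\<in>UNIV. krawtchouk w (wsum f g t))"
proof -
  have "(\<Sum>t\<in>UNIV. krawtchouk w (wsum f g t)) =
      (\<Sum>S\<in>{S. S \<subseteq> nonzeros \<and> card S = w}. \<Sum>t\<in>UNIV. \<Prod>x\<in>S. phase f g t x)"
    by (subst sum.swap) (simp add: sum_prod_phase_eq_krawtchouk assms)
  also have "\<dots> = (\<Sum>S\<in>{S \<in> {S. S \<subseteq> nonzeros \<and> card S = w}.
      (\<Sum>x\<in>S. x) = 0 \<and> (\<Sum>x\<in>S. f x) = 0 \<and> (\<Sum>x\<in>S. g x) = 0}. 2 ^ (3 * n))"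
    unfolding sum_prod_phase by (subst sum.inter_filter) simp_all
  also have "{S \<in> {S. S \<subseteq> nonzeros \<and> card S = w}.
      (\<Sum>x\<in>S. x) = 0 \<and> (\<Sum>x\<in>S. f x) = 0 \<and> (\<Sum>x\<in>S. g x) = 0} = {S \<in> fun_code f g. card S = w}"
    by (auto simp: fun_code_def)
  finally show ?thesis
    by (simp add: weight_distribution_def mult.commute)
qed

lemma weight_distribution_eqI:
  assumes "f 0 = 0" "g 0 = 0" "f' 0 = 0" "g' 0 = 0"
    and "\<And>v. card {t. wsum f g t = v} = card {t. wsum f' g' t = v}"
  shows "weight_distribution (fun_code f g) = weight_distribution (fun_code f' g')"
proof
  fix w
  let ?W = "range (wsum f g) \<union> range (wsum f' g')"
  have "(\<Sum>t\<in>UNIV. krawtchouk w (wsum f g t)) = (\<Sum>t\<in>UNIV. krawtchouk w (wsum f' g' t))"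
    using sum_comp_eq_sum_card_fibres[of UNIV ?W "wsum f g" "krawtchouk w"]
      sum_comp_eq_sum_card_fibres[of UNIV ?W "wsum f' g'" "krawtchouk w"]
    by (simp add: assms(5))
  hence "2 ^ (3 * n) * int (weight_distribution (fun_code f g) w) =
      2 ^ (3 * n) * int (weight_distribution (fun_code f' g') w)"
    using assms(1-4) by (simp add: macwilliams_identity)
  thus "weight_distribution (fun_code f g) w = weight_distribution (fun_code f' g') w"
    by simp
qed

text \<open>The same double count over all supports: for each triple the sum factors into terms 1 +
  sign, and the product survives only if every sign is 1, that is, if \<open>wsum\<close> is
  2^n.\<close>

lemma card_fun_code:
  assumes "f 0 = 0" "g 0 = 0"
  shows "2 ^ (3 * n) * card (fun_code f g) = 2 ^ (2 ^ n - 1) * card {t. wsum f g t = 2 ^ n}"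
proof -
  let ?N = "nonzeros :: 'a set"
  have card_N: "card ?N = 2 ^ n - 1"
    by (simp add: nonzeros_def Compl_eq_Diff_UNIV card_field)
  have full: "(\<Prod>x\<in>?N. 1 + phase f g t x) = (if wsum f g t = 2 ^ n then 2 ^ (2 ^ n - 1) else 0)" for t
  proof (cases "\<forall>x\<in>?N. phase f g t x = 1")
    case True
    hence 1: "phase f g t x = 1" for x
      using assms by (cases "x = 0") (auto simp: phase_def nonzeros_def)
    hence "wsum f g t = 2 ^ n"
      by (simp add: wsum_def card_field)
    thus ?thesis using 1 by (simp add: card_N)
  next
    case False
    then obtain x where x: "x \<in> ?N" "phase f g t x = -1"
      using phase_cases by blast
    have "phase f g t y \<le> 1" for y
      using phase_cases[of f g t y] by auto
    hence "wsum f g t < (\<Sum>y\<in>(UNIV::'a set). 1)"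
      unfolding wsum_def by (intro sum_strict_mono_ex1) (use x in \<open>auto intro!: exI[of _ x]\<close>)
    hence "wsum f g t \<noteq> 2 ^ n"
      by (simp add: card_field)
    moreover have "(\<Prod>x\<in>?N. 1 + phase f g t x) = 0"
      using x by (intro prod_zero) (auto intro!: bexI[of _ x])
    ultimately show ?thesis by simp
  qed
  have "2 ^ (3 * n) * int (card (fun_code f g)) =
      (\<Sum>S\<in>{S \<in> Pow ?N. (\<Sum>x\<in>S. x) = 0 \<and> (\<Sum>x\<in>S. f x) = 0 \<and> (\<Sum>x\<in>S. g x) = 0}. 2 ^ (3 * n))"
    by (simp add: fun_code_def Pow_def mult.commute)
  also have "\<dots> = (\<Sum>S\<in>Pow ?N. \<Sum>t\<in>UNIV. \<Prod>x\<in>S. phase f g t x)"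
    unfolding sum_prod_phase by (subst sum.inter_filter) simp_all
  also have "\<dots> = (\<Sum>t\<in>UNIV. \<Prod>x\<in>?N. phase f g t x + 1)"
    by (subst sum.swap) (simp add: prod_add)
  also have "\<dots> = (\<Sum>t\<in>UNIV. if wsum f g t = 2 ^ n then 2 ^ (2 ^ n - 1) else 0)"
    by (simp add: full add.commute)
  also have "\<dots> = 2 ^ (2 ^ n - 1) * int (card {t. wsum f g t = 2 ^ n})"
    by (subst sum.inter_filter[symmetric]) simp_all
  finally have "int (2 ^ (3 * n) * card (fun_code f g)) = int (2 ^ (2 ^ n - 1) * card {t. wsum f g t = 2 ^ n})"
    by simp
  thus ?thesis
    by (simp only: of_nat_eq_iff)
qed

end

subsection \<open>Linearized polynomials and quadratic character sums\<close>

context odd_binary_field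
begin

definition lin :: "nat \<Rightarrow> (nat \<Rightarrow> 'a) \<Rightarrow> nat \<Rightarrow> 'a \<Rightarrow> 'a" where
  "lin t c m x = (\<Sum>i\<le>m. c i * x ^ (2 ^ (t * i)))"

lemma lin_add: "lin t c m (x + y) = lin t c m x + lin t c m y"
  by (simp add: lin_def frobenius_add distrib_left sum.distrib)

text \<open>Right division of a linearized polynomial with root \<open>1\<close> by \<open>y + y ^ (2 ^ t)\<close> is
  summation by parts.\<close>
lemma lin_eq_lin_partial_sums:
  "lin t c (Suc m) y = lin t (\<lambda>i. \<Sum>j\<le>i. c j) m (y + y ^ (2 ^ t)) + (\<Sum>j\<le>Suc m. c j) * y ^ (2 ^ (t * Suc m))"
proof (induction m)
  case 0
  show ?case
    by (simp add: lin_def algebra_simps)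
next
  case (Suc m)
  have pow: "(y ^ (2 ^ t)) ^ (2 ^ (t * i)) = y ^ (2 ^ (t * Suc i))" for i
    by (simp add: power_add flip: power_mult)
  have "lin t c (Suc (Suc m)) y = lin t c (Suc m) y + c (Suc (Suc m)) * y ^ (2 ^ (t * Suc (Suc m)))"
    by (simp add: lin_def)
  also have "\<dots> = lin t (\<lambda>i. \<Sum>j\<le>i. c j) m (y + y ^ (2 ^ t)) +
      (\<Sum>j\<le>Suc m. c j) * (y ^ (2 ^ (t * Suc m)) + y ^ (2 ^ (t * Suc (Suc m)))) +
      ((\<Sum>j\<le>Suc m. c j) + c (Suc (Suc m))) * y ^ (2 ^ (t * Suc (Suc m)))"
    unfolding Suc.IH distrib_left distrib_right by (simp only: add_ac add_self add_self_left add_0_right)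
  also have "\<dots> = lin t (\<lambda>i. \<Sum>j\<le>i. c j) (Suc m) (y + y ^ (2 ^ t)) +
      (\<Sum>j\<le>Suc (Suc m). c j) * y ^ (2 ^ (t * Suc (Suc m)))"
    unfolding lin_def sum.atMost_Suc[of _ m] frobenius_add[of y] pow sum.atMost_Suc[of _ "Suc m"] ..
  finally show ?case .
qed

text \<open>Scaling moves a nonzero root \<open>a\<close> to 1. Right division by y + y^(2^t), whose
  kernel is {0, 1} by coprimality, then lowers the degree by one and halves \<open>K\<close>.
  \<open>K\<close> is any subgroup of the kernel, since its image under \<phi> need not fill the
  next kernel.\<close>

lemma card_lin_kernel:
  assumes "coprime t n" "\<exists>i\<le>m. c i \<noteq> 0"
    and "0 \<in> K" "\<And>x y. x \<in> K \<Longrightarrow> y \<in> K \<Longrightarrow> x + y \<in> K" "\<And>x. x \<in> K \<Longrightarrow> lin t c m x = 0"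
  shows "\<exists>d\<le>m. card K = 2 ^ d"
  using assms(2-)
proof (induction m arbitrary: c K)
  case 0
  hence "K = {0}"
    by (auto simp: lin_def)
  thus ?case by simp
next
  case (Suc m)
  show ?case
  proof (cases "K = {0}")
    case True
    thus ?thesis by (intro exI[of _ 0]) simp
  next
    case False
    then obtain a where a: "a \<in> K" "a \<noteq> 0"
      using Suc.prems(2) by auto
    define \<phi> where "\<phi> x = x / a + (x / a) ^ (2 ^ t)" for x
    define c' where "c' i = c i * a ^ (2 ^ (t * i))" for i
    define D where "D i = (\<Sum>j\<le>i. c' j)" for i
    have \<phi>_add: "\<phi> (x + y) = \<phi> x + \<phi> y" for x y
      by (simp add: \<phi>_def add_divide_distrib frobenius_add add_ac)
    have \<phi>_0: "\<phi> x = 0 \<longleftrightarrow> x = 0 \<or> x = a" for x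
    proof -
      have "\<phi> x = 0 \<longleftrightarrow> (x / a) ^ (2 ^ t) = x / a"
        unfolding \<phi>_def add_eq_0_iff by (rule eq_commute)
      also have "\<dots> \<longleftrightarrow> x / a = 0 \<or> x / a = 1"
        using frobenius_fixed[OF assms(1), of "x / a"] by (auto simp: power_0_left)
      finally show ?thesis using a by simp
    qed
    have c_c': "lin t c (Suc m) x = lin t c' (Suc m) (x / a)" for x
      using a by (simp add: lin_def c'_def power_divide)
    \<comment> \<open>The full coefficient sum is the value of the original polynomial at
      \<open>a\<close>, so the division leaves no remainder.\<close>
    have "D (Suc m) = 0"
      using Suc.prems(4)[OF a(1)] a by (simp add: c_c') (simp add: lin_def D_def)
    hence lin_D: "lin t c (Suc m) x = lin t D m (\<phi> x)" for x
      using c_c'[of x] lin_eq_lin_partial_sums[of t c' m "x / a"]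
      by (simp add: \<phi>_def D_def[abs_def] del: sum.atMost_Suc)
    \<comment> \<open>Consecutive differences of the partial sums recover the coefficients, which
      are not all zero.\<close>
    have "\<exists>i\<le>m. D i \<noteq> 0"
    proof (rule ccontr)
      assume "\<not> ?thesis"
      hence D0: "D i = 0" if "i \<le> Suc m" for i
        using that \<open>D (Suc m) = 0\<close> by (auto simp: le_Suc_eq)
      have "c' i = 0" if "i \<le> Suc m" for i
      proof (cases i)
        case 0
        thus ?thesis using D0[of 0] by (simp add: D_def)
      next
        case (Suc j)
        thus ?thesis using D0[of j] D0[of i] that by (simp add: D_def)
      qed
      thus False
        using Suc.prems(1) a by (auto simp: c'_def)
    qed
    moreover have "0 \<in> \<phi> ` K"
      using \<phi>_0[of 0] Suc.prems(2) by force
    moreover have "x + y \<in> \<phi> ` K" if "x \<in> \<phi> ` K" "y \<in> \<phi> ` K" for x y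
      using that Suc.prems(3) by (auto simp flip: \<phi>_add)
    moreover have "lin t D m x = 0" if "x \<in> \<phi> ` K" for x
      using that Suc.prems(4) by (auto simp flip: lin_D)
    ultimately obtain d where d: "d \<le> m" "card (\<phi> ` K) = 2 ^ d"
      using Suc.IH[of D "\<phi> ` K"] by blast
    have "card {x \<in> K. \<phi> x = v} = 2" if v: "v \<in> \<phi> ` K" for v
    proof -
      obtain x where x: "x \<in> K" "v = \<phi> x" using v by auto
      have "\<phi> y = \<phi> x \<longleftrightarrow> \<phi> (y + x) = 0" for y
        by (simp add: \<phi>_add)
      hence "\<phi> y = \<phi> x \<longleftrightarrow> y = x \<or> y = x + a" for y
        unfolding \<phi>_0 by (simp add: add_eq_iff_eq_add add.commute[of a])
      hence "{y \<in> K. \<phi> y = v} = {x, x + a}"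
        using x a Suc.prems(3) by auto
      thus ?thesis using a by simp
    qed
    hence "int (card K) = 2 * int (card (\<phi> ` K))"
      using sum_comp_eq_sum_card_fibres[of K "\<phi> ` K" \<phi> "\<lambda>_. 1"] by simp
    hence "card K = 2 * card (\<phi> ` K)"
      by linarith
    hence "card K = 2 ^ Suc d"
      using d by simp
    thus ?thesis
      using d by (intro exI[of _ "Suc d"]) simp
  qed
qed

text \<open>Squaring, replacing z by x + z and using orthogonality in \<open>G x\<close> leaves 2^n
  times the sum over the radical \<open>K\<close>. There \<open>chi (Q z)\<close> is multiplicative,
  so that sum is \<open>card K\<close> or 0.\<close>

lemma quadratic_character_sum:
  assumes "coprime t n" "\<exists>i\<le>m. c i \<noteq> 0" "bij G" "Q 0 = 0"
    and Q: "\<And>x z. chi (Q (x + z)) = chi (Q x) * chi (Q z) * chi (G x * lin t c m z)"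
    and nz: "(\<Sum>x\<in>UNIV. chi (Q x)) \<noteq> 0"
  shows "\<exists>d\<le>m. (\<Sum>x\<in>UNIV. chi (Q x)) ^ 2 = 2 ^ (n + d)"
proof -
  let ?S = "\<Sum>x\<in>UNIV. chi (Q x)"
  define K where "K = {z. lin t c m z = 0}"
  have "lin t c m 0 = 0"
    by (simp add: lin_def power_0_left)
  hence K: "0 \<in> K" "\<And>x y. x \<in> K \<Longrightarrow> y \<in> K \<Longrightarrow> x + y \<in> K"
    by (simp_all add: K_def lin_add)
  have "?S ^ 2 = (\<Sum>x\<in>UNIV. \<Sum>z\<in>UNIV. chi (Q x) * chi (Q z))"
    by (simp add: power2_eq_square sum_product)
  also have "\<dots> = (\<Sum>x\<in>UNIV. \<Sum>z\<in>UNIV. chi (Q x) * chi (Q (x + z)))"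
  proof (rule sum.cong[OF refl])
    fix x
    show "(\<Sum>z\<in>UNIV. chi (Q x) * chi (Q z)) = (\<Sum>z\<in>UNIV. chi (Q x) * chi (Q (x + z)))"
      by (rule sum.reindex_bij_witness[of _ "\<lambda>z. x + z" "\<lambda>z. x + z"]) simp_all
  qed
  also have "\<dots> = (\<Sum>z\<in>UNIV. chi (Q z) * (\<Sum>x\<in>UNIV. chi (G x * lin t c m z)))"
    unfolding Q sum_distrib_left
    by (subst sum.swap) (simp add: mult.assoc[symmetric])
  also have "\<dots> = (\<Sum>z\<in>UNIV. chi (Q z) * (if lin t c m z = 0 then 2 ^ n else 0))"
    using sum.reindex_bij_betw[OF assms(3), where g = "\<lambda>y. chi (y * lin t c m z)" for z]
    by (simp add: chi_orthogonal)
  also have "\<dots> = 2 ^ n * (\<Sum>z\<in>K. chi (Q z))"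
    unfolding K_def sum_distrib_left by (intro sum.mono_neutral_cong_right) auto
  finally have S: "?S ^ 2 = 2 ^ n * (\<Sum>z\<in>K. chi (Q z))" .
  have Q_K: "chi (Q (x + z)) = chi (Q x) * chi (Q z)" if "z \<in> K" for x z
    using that by (simp add: Q K_def)
  have "chi (Q z) = 1" if "z \<in> K" for z
  proof (rule ccontr)
    assume "chi (Q z) \<noteq> 1"
    hence "chi (Q z) = -1" using chi_cases by blast
    moreover have "(\<Sum>x\<in>K. chi (Q x)) = (\<Sum>x\<in>K. chi (Q (x + z)))"
      by (rule sum.reindex_bij_witness[of _ "\<lambda>x. x + z" "\<lambda>x. x + z"])
        (use K that in \<open>simp_all add: add.assoc\<close>)
    ultimately have "(\<Sum>x\<in>K. chi (Q x)) = 0"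
      using that by (simp add: Q_K sum_negf)
    thus False using S nz by simp
  qed
  hence "?S ^ 2 = 2 ^ n * int (card K)"
    using S by simp
  moreover have "\<exists>d\<le>m. card K = 2 ^ d"
    by (rule card_lin_kernel[OF assms(1,2) K]) (simp_all add: K_def)
  then obtain d where "d \<le> m" "card K = 2 ^ d" by blast
  ultimately show ?thesis
    by (intro exI[of _ d]) (simp add: power_add)
qed

text \<open>Written as a list so that its length bounds the cardinality.\<close>

definition spectrum :: "int set" where
  "spectrum = set [0, 2 ^ ((n + 1) div 2), - (2 ^ ((n + 1) div 2)), 2 ^ ((n + 3) div 2),
     - (2 ^ ((n + 3) div 2)), 2 ^ ((n + 5) div 2), - (2 ^ ((n + 5) div 2))]"

lemma card_spectrum: "card spectrum \<le> 7"
  unfolding spectrum_def by (rule card_length[THEN order_trans]) simp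

text \<open>Up to sign \<open>s\<close> is a power of two, so n + d is even; as n is odd, d is 1, 3
  or 5.\<close>

lemma in_spectrum:
  assumes "s\<^sup>2 = 2 ^ (n + d)" "d \<le> 5"
  shows "s \<in> spectrum"
proof -
  have "int (nat \<bar>s\<bar> ^ 2) = int (2 ^ (n + d))"
    using assms(1) by simp
  hence "nat \<bar>s\<bar> ^ 2 = 2 ^ (n + d)"
    by (simp only: of_nat_eq_iff)
  moreover from this have "nat \<bar>s\<bar> dvd 2 ^ (n + d)"
    by (metis dvd_triv_left power2_eq_square)
  then obtain e where e: "nat \<bar>s\<bar> = 2 ^ e"
    using divides_primepow_nat[OF two_is_prime_nat] by blast
  ultimately have "(2::nat) ^ (2 * e) = 2 ^ (n + d)"
    by (simp add: mult.commute flip: power_mult)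
  hence "2 * e = n + d"
    by (simp only: power_inject_exp one_less_numeral_iff semiring_norm)
  hence "e = (n + 1) div 2 \<or> e = (n + 3) div 2 \<or> e = (n + 5) div 2"
  proof -
    obtain m where m: "n = 2 * m + 1" using odd_n by (rule oddE)
    have "e = m + 1 \<or> e = m + 2 \<or> e = m + 3"
      using \<open>2 * e = n + d\<close> assms(2) unfolding m by linarith
    thus ?thesis by (auto simp: m)
  qed
  moreover have "int (nat \<bar>s\<bar>) = 2 ^ e"
    by (simp only: e of_nat_power of_nat_numeral)
  hence "s = 2 ^ e \<or> s = - (2 ^ e)"
    by linarith
  ultimately show ?thesis
    unfolding spectrum_def by auto
qed

subsection \<open>Linearized annihilators\<close>

fun span_list :: "'a list \<Rightarrow> 'a set" where
  "span_list [] = {0}"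
| "span_list (a # as) = {x. x \<in> span_list as \<or> x + a \<in> span_list as}"

text \<open>A linearized polynomial meant to vanish exactly on the span. If \<alpha> is the previous
  value at \<open>a\<close>, then y^(2^t) + \<alpha>^(2^t - 1) y is made to have the roots 0 and
  \<alpha>.\<close>

fun annihilator :: "nat \<Rightarrow> 'a list \<Rightarrow> 'a \<Rightarrow> 'a" where
  "annihilator t [] x = x"
| "annihilator t (a # as) x =
     annihilator t as x ^ (2 ^ t) + annihilator t as a ^ (2 ^ t - 1) * annihilator t as x"

lemma annihilator_add: "annihilator t as (x + y) = annihilator t as x + annihilator t as y"
  by (induction as) (simp_all add: frobenius_add distrib_left add_ac)

lemma annihilator_sum: "annihilator t as (\<Sum>i\<in>A. f i) = (\<Sum>i\<in>A. annihilator t as (f i))"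
proof (induction A rule: infinite_finite_induct)
  case (infinite A)
  show ?case using annihilator_add[of t as 0 0] infinite by simp
next
  case empty
  show ?case using annihilator_add[of t as 0 0] by simp
qed (simp add: annihilator_add)

text \<open>Scaling by the value at \<open>a\<close> reduces the new factor to y^(2^t) + y, with
  roots 0 and 1. If \<open>a\<close> already lies in the span, that value is 0 and, because
  \<open>t > 0\<close>, the factor is a mere Frobenius power.\<close>

lemma annihilator_eq_0_iff:
  assumes "coprime t n" "t > 0"
  shows "annihilator t as x = 0 \<longleftrightarrow> x \<in> span_list as"
proof (induction as arbitrary: x)
  case (Cons a as)
  let ?x = "annihilator t as x" and ?a = "annihilator t as a"
  have t: "(2::nat) ^ t - 1 > 0"
    using one_less_power[of "2::nat" t] assms(2) by simp
  have "annihilator t (a # as) x = 0 \<longleftrightarrow> ?x = 0 \<or> ?x = ?a"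
  proof (cases "?a = 0")
    case True
    thus ?thesis using t by (simp add: power_0_left)
  next
    case False
    have eq: "annihilator t (a # as) x = ?a ^ (2 ^ t) * ((?x / ?a) ^ (2 ^ t) + ?x / ?a)"
    proof -
      have "?a ^ (2 ^ t) * (?x / ?a) = ?a ^ (2 ^ t - 1) * ?a * (?x / ?a)"
        by (simp only: power_minus_mult zero_less_power zero_less_numeral)
      thus ?thesis
        using False by (simp add: power_divide distrib_left)
    qed
    have "annihilator t (a # as) x = 0 \<longleftrightarrow> (?x / ?a) ^ (2 ^ t) = ?x / ?a"
      unfolding eq mult_eq_0_iff add_eq_0_iff using False by simp
    also have "\<dots> \<longleftrightarrow> ?x / ?a = 0 \<or> ?x / ?a = 1"
      using frobenius_fixed[OF assms(1), of "?x / ?a"] by (auto simp: power_0_left)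
    finally show ?thesis using False by simp
  qed
  also have "?x = ?a \<longleftrightarrow> annihilator t as (x + a) = 0"
    by (simp add: annihilator_add)
  finally show ?case
    by (simp add: Cons.IH)
qed simp

lemma annihilator_eq_lin: "\<exists>c. \<forall>x. annihilator t as x = lin t c (length as) x"
proof (induction as)
  case Nil
  show ?case
    by (intro exI[of _ "\<lambda>_. 1"]) (simp add: lin_def)
next
  case (Cons a as)
  then obtain c where c: "\<And>x. annihilator t as x = lin t c (length as) x" by blast
  let ?m = "length as" and ?e = "annihilator t as a ^ (2 ^ t - 1)"
  \<comment> \<open>Frobenius shifts the coefficients up by one place; the guard cuts off values of
    \<open>c\<close> beyond the degree.\<close>
  let ?c = "\<lambda>i. (case i of 0 \<Rightarrow> 0 | Suc j \<Rightarrow> c j ^ (2 ^ t)) + (if i \<le> ?m then ?e * c i else 0)"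
  have "annihilator t (a # as) x = lin t ?c (Suc ?m) x" for x
  proof -
    have "(x ^ (2 ^ (t * i))) ^ (2 ^ t) = x ^ (2 ^ (t * Suc i))" for i
      by (simp add: power_add mult.commute flip: power_mult)
    hence "lin t c ?m x ^ (2 ^ t) = (\<Sum>i\<le>?m. c i ^ (2 ^ t) * x ^ (2 ^ (t * Suc i)))"
      by (simp only: lin_def frobenius_sum power_mult_distrib)
    also have "\<dots> = (\<Sum>i\<le>Suc ?m. (case i of 0 \<Rightarrow> 0 | Suc j \<Rightarrow> c j ^ (2 ^ t)) * x ^ (2 ^ (t * i)))"
      by (subst sum.atMost_Suc_shift) simp
    finally have 1: "lin t c ?m x ^ (2 ^ t) = \<dots>" .
    have 2: "?e * lin t c ?m x = (\<Sum>i\<le>Suc ?m. (if i \<le> ?m then ?e * c i else 0) * x ^ (2 ^ (t * i)))"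
      by (simp add: lin_def sum_distrib_left mult.assoc)
    have "annihilator t (a # as) x = lin t c ?m x ^ (2 ^ t) + ?e * lin t c ?m x"
      by (simp add: c)
    also have "\<dots> = lin t ?c (Suc ?m) x"
      unfolding 1 2 unfolding lin_def by (simp only: sum.distrib distrib_right)
    finally show ?thesis .
  qed
  thus ?case by auto
qed

lemma zero_in_span_list: "0 \<in> span_list as"
  by (induction as) auto

text \<open>The greedy choice of \<open>as\<close> below makes its span a hyperplane of the span of \<open>S\<close>, where the
  annihilator takes a single nonzero value on the complement; so \<open>S\<close> minus that hyperplane
  sums to zero.\<close>
lemma no_short_word:
  fixes S :: "'a set"
  assumes t: "coprime t n" "t > 0" and S: "S \<noteq> {}" "0 \<notin> S" "card S \<le> 6"
    and sums: "\<And>i. i \<le> 5 \<Longrightarrow> (\<Sum>x\<in>S. x ^ (2 ^ e) * x ^ (2 ^ (t * i))) = 0"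
  shows False
proof -
  \<comment> \<open>As some element of \<open>S\<close> stays outside the span, the length condition
    bounds the degree of the annihilator by 5.\<close>
  define P where "P as \<longleftrightarrow> length as \<le> card (S \<inter> span_list as) \<and> \<not> S \<subseteq> span_list as" for as
  have "P []" using S by (auto simp: P_def)
  moreover have "\<forall>bs. P bs \<longrightarrow> card (S \<inter> span_list bs) < Suc (card S)"
    by (simp add: less_Suc_eq_le card_mono)
  ultimately obtain as where as: "P as" and max: "\<And>bs. P bs \<Longrightarrow> card (S \<inter> span_list bs) \<le> card (S \<inter> span_list as)"
    using ex_has_greatest_nat[of P "[]" "\<lambda>bs. card (S \<inter> span_list bs)" "Suc (card S)"] by blast
  define T where "T = S - span_list as"
  have card_T: "card T + card (S \<inter> span_list as) = card S"
    unfolding T_def by (subst add.commute, rule card_Int_Diff[symmetric]) simp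
  have T_ne: "T \<noteq> {}" using as by (auto simp: P_def T_def)
  hence "card T > 0" by (simp add: card_gt_0_iff)
  hence len: "length as \<le> 5" using as card_T S(3) by (simp add: P_def)
  let ?A = "annihilator t as"
  \<comment> \<open>Appending \<open>x\<close> catches at least one more element, so by maximality
    \<open>P\<close> can fail only because the larger span contains \<open>S\<close>; hence x + y
    lies in the old span.\<close>
  have A: "?A x = ?A y" if "x \<in> T" "y \<in> T" for x y
  proof -
    let ?bs = "x # as"
    have "insert x (S \<inter> span_list as) \<subseteq> S \<inter> span_list ?bs"
      using that(1) by (auto simp: T_def zero_in_span_list)
    hence "card (insert x (S \<inter> span_list as)) \<le> card (S \<inter> span_list ?bs)"
      by (intro card_mono) auto
    hence c: "Suc (card (S \<inter> span_list as)) \<le> card (S \<inter> span_list ?bs)"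
      using that(1) by (simp add: T_def)
    hence "\<not> P ?bs" using max[of ?bs] by auto
    hence "S \<subseteq> span_list ?bs"
      using c as by (auto simp: P_def)
    hence "y + x \<in> span_list as"
      using that(2) by (auto simp: T_def)
    thus ?thesis
      using annihilator_eq_0_iff[OF t, of as "y + x"] by (simp add: annihilator_add)
  qed
  obtain x0 where x0: "x0 \<in> T" using T_ne by blast
  have A_x0: "?A x0 \<noteq> 0" using x0 annihilator_eq_0_iff[OF t] by (auto simp: T_def)
  obtain c where c: "\<And>x. ?A x = lin t c (length as) x"
    using annihilator_eq_lin by blast
  \<comment> \<open>The annihilator vanishes on \<open>S - T\<close>, so the sum extends to
    \<open>S\<close> and becomes a combination of the given power sums.\<close>
  have "(\<Sum>x\<in>T. x ^ (2 ^ e) * ?A x) = (\<Sum>x\<in>S. x ^ (2 ^ e) * ?A x)"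
    by (intro sum.mono_neutral_left) (auto simp: T_def annihilator_eq_0_iff[OF t])
  also have "\<dots> = (\<Sum>i\<le>length as. c i * (\<Sum>x\<in>S. x ^ (2 ^ e) * x ^ (2 ^ (t * i))))"
    unfolding c lin_def sum_distrib_left by (subst sum.swap) (simp add: mult_ac)
  also have "\<dots> = 0"
    using len by (intro sum.neutral) (auto simp: sums)
  finally have "(\<Sum>x\<in>T. x ^ (2 ^ e) * ?A x0) = 0"
    using A[OF _ x0] by (metis (no_types, lifting) sum.cong)
  hence "(\<Sum>x\<in>T. x) ^ (2 ^ e) * ?A x0 = 0"
    by (simp add: frobenius_sum sum_distrib_right)
  hence T_sum: "(\<Sum>x\<in>T. x) = 0" using A_x0 by simp
  \<comment> \<open>By additivity \<open>card T\<close> copies of one nonzero value add up to 0, so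
    \<open>card T\<close> is even; it is not 2, since distinct elements do not cancel.\<close>
  have "(\<Sum>x\<in>T. ?A x0) = ?A (\<Sum>x\<in>T. x)"
    unfolding annihilator_sum using A[OF x0] by (intro sum.cong) auto
  hence "of_nat (card T) * ?A x0 = 0"
    using T_sum annihilator_add[of t as 0 0] by simp
  hence "of_nat (card T) = (0::'a)" using A_x0 by simp
  moreover have "of_nat (2 * j + 1) = (1::'a)" for j
    by (induction j) (simp_all add: add.assoc)
  ultimately have "even (card T)"
    by (metis oddE zero_neq_one)
  moreover have "card T \<noteq> 2"
  proof
    assume "card T = 2"
    then obtain x y where "T = {x, y}" "x \<noteq> y" by (auto simp: card_2_iff)
    thus False using T_sum by simp
  qed
  ultimately have T4: "card T \<ge> 4"
    using \<open>card T > 0\<close> by presburger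
  obtain a where "a \<in> S" using S(1) by blast
  have "\<not> S \<subseteq> {a}"
  proof
    assume "S \<subseteq> {a}"
    hence "card S \<le> card {a}" by (intro card_mono) auto
    thus False using T4 card_T by simp
  qed
  then obtain b where ab: "a \<in> S" "b \<in> S" "a \<noteq> b" using \<open>a \<in> S\<close> by blast
  \<comment> \<open>Any two elements of \<open>S\<close> give a list satisfying \<open>P\<close>, so
    the maximal span catches at least 2. With \<open>card T\<close> at least 4 and
    \<open>card S\<close> at most 6, both bounds are attained and a + b is not in
    \<open>S\<close>.\<close>
  have ab_sum: "S \<inter> span_list [b, a] = {a, b} \<and> card S = 6" if "a \<in> S" "b \<in> S" "a \<noteq> b" for a b
  proof -
    have sub: "{a, b} \<subseteq> S \<inter> span_list [b, a]" using that by auto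
    hence 2: "2 \<le> card (S \<inter> span_list [b, a])"
      using card_mono[OF _ sub] that by simp
    have "\<not> S \<subseteq> span_list [b, a]"
    proof
      assume "S \<subseteq> span_list [b, a]"
      hence "S \<subseteq> {a, b, a + b}" using S(2) by (auto simp: add_eq_iff_eq_add)
      hence "card S \<le> card {a, b, a + b}" by (intro card_mono) auto
      also have "\<dots> \<le> 3" by (simp add: card_insert_if)
      finally show False using T4 card_T by simp
    qed
    hence "P [b, a]" using 2 by (simp add: P_def)
    from max[OF this] have *: "card (S \<inter> span_list [b, a]) = 2" "card S = 6"
      using 2 T4 card_T S(3) by linarith+
    have "{a, b} = S \<inter> span_list [b, a]"
      by (rule card_subset_eq) (use * sub that in auto)
    thus ?thesis using * by simp
  qed
  have le2: "card (S \<inter> span_list as) \<le> 2" using T4 card_T S(3) by linarith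
  have "\<not> S \<subseteq> {a, b}"
  proof
    assume "S \<subseteq> {a, b}"
    hence "card S \<le> card {a, b}" by (intro card_mono) auto
    thus False using ab T4 card_T by simp
  qed
  then obtain d where d: "d \<in> S" "d \<noteq> a" "d \<noteq> b" by auto
  \<comment> \<open>Catching 3 elements exceeds the maximum, so \<open>S\<close> lies in the span of
    a, b, d. Without 0 and sums of two elements only four candidates remain, against
    \<open>card S = 6\<close>.\<close>
  have "{a, b, d} \<subseteq> S \<inter> span_list [d, b, a]" using ab d by auto
  hence "card {a, b, d} \<le> card (S \<inter> span_list [d, b, a])" by (intro card_mono) auto
  hence 3: "3 \<le> card (S \<inter> span_list [d, b, a])" using ab d by auto
  hence "\<not> P [d, b, a]" using max[of "[d, b, a]"] le2 by auto
  hence S_sub: "S \<subseteq> span_list [d, b, a]" using 3 by (simp add: P_def)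
  have no_sum: "x + y \<notin> S" if "x \<in> S" "y \<in> S" "x \<noteq> y" for x y
  proof
    assume "x + y \<in> S"
    moreover have "x + y \<in> span_list [y, x]"
      by (simp add: add.assoc)
    ultimately have "x + y \<in> {x, y}"
      using ab_sum[OF that] by blast
    thus False
      using S(2) that by auto
  qed
  have "z \<in> {a, b, d, a + b + d}" if "z \<in> S" for z
  proof -
    have "z \<in> span_list [d, b, a]"
      using S_sub \<open>z \<in> S\<close> by (rule subsetD)
    hence "z \<in> {0, a, b, a + b, d, a + d, b + d, a + b + d}"
      by (simp only: span_list.simps mem_Collect_eq singleton_iff add_eq_iff_eq_add add_0_right insert_iff)
        (elim disjE; simp only: add_ac simp_thms empty_iff)
    moreover have "z \<noteq> 0" "z \<noteq> a + b" "z \<noteq> a + d" "z \<noteq> b + d"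
      using no_sum[of a b] no_sum[of a d] no_sum[of b d] ab d S(2) \<open>z \<in> S\<close> by auto
    ultimately show ?thesis by blast
  qed
  hence "S \<subseteq> {a, b, d, a + b + d}" by blast
  hence "card S \<le> card {a, b, d, a + b + d}" by (intro card_mono) auto
  also have "\<dots> \<le> 4" by (simp add: card_insert_if)
  finally show False using ab_sum[OF ab] by simp
qed

end

subsection \<open>The two codes\<close>

context odd_binary_field
begin

lemma bij_frobenius: "bij (\<lambda>x::'a. x ^ (2 ^ m))"
  by (intro finite_UNIV_inj_surj[of "\<lambda>x::'a. x ^ (2 ^ m)", THEN bijI[rotated]])
    (auto simp: inj_def frobenius_inj)

lemma gold_add:
  "((x::'a) + z) ^ (2 ^ m + 1) = x ^ (2 ^ m + 1) + z ^ (2 ^ m + 1) + (x ^ (2 ^ m) * z + x * z ^ (2 ^ m))"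
  by (simp add: frobenius_add algebra_simps)

lemma gold_exponents: "(2::nat) ^ 1 + 1 = 3" "(2::nat) ^ 2 + 1 = 5"
  by simp_all

lemma power_frobenius: "((x::'a) ^ (2 ^ i)) ^ (2 ^ j) = x ^ (2 ^ (i + j))"
  by (simp add: power_add power_mult)

text \<open>Frobenius invariance of \<open>chi\<close> brings every polar term to a multiple of x^4,
  leaving a linearized polynomial in z of degree at most 4. The value 2^n would give n = d, at most
  4.\<close>

lemma bch_sum_in_spectrum:
  assumes "(a, b, c) \<noteq> (0, 0, 0)"
  shows "wsum (\<lambda>x. x ^ 3) (\<lambda>x. x ^ 5) (a, b, c) \<in> spectrum"
    and "n \<ge> 5 \<Longrightarrow> wsum (\<lambda>x. x ^ 3) (\<lambda>x. x ^ 5) (a, b, c) \<noteq> 2 ^ n"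
proof -
  define Q where "Q x = a * x + b * x ^ 3 + c * x ^ 5" for x
  define S where "S = (\<Sum>x\<in>UNIV. chi (Q x))"
  have wsum: "wsum (\<lambda>x. x ^ 3) (\<lambda>x. x ^ 5) (a, b, c) = S"
    by (simp add: wsum_def phase_def Q_def S_def)
  have "S = 0 \<or> (\<exists>d\<le>4. S\<^sup>2 = 2 ^ (n + d))"
  proof (cases "b = 0 \<and> c = 0")
    case True
    thus ?thesis
      using assms chi_orthogonal[of a] by (simp add: S_def Q_def mult.commute)
  next
    case False
    \<comment> \<open>The coefficients of z, z^2, z^4, z^8 and z^16.\<close>
    define e where "e i = [c, b ^ 2, 0, b ^ 4, c ^ 4] ! i" for i
    have e0: "\<exists>i\<le>4. e i \<noteq> 0"
    proof (cases "c = 0")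
      case True
      thus ?thesis using False by (intro exI[of _ 1]) (simp add: e_def)
    qed (intro exI[of _ 0], simp add: e_def)
    have chi_eq: "chi (Q (x + z)) = chi (Q x) * chi (Q z) * chi (x ^ (2 ^ 2) * lin 1 e 4 z)" for x z
    proof -
      have Q: "Q (x + z) = Q x + Q z + (b * (x ^ 2 * z) + b * (x * z ^ 2) + (c * (x ^ 4 * z) + c * (x * z ^ 4)))"
      proof -
        have "(x + z) ^ 3 = x ^ 3 + z ^ 3 + (x ^ 2 * z + x * z ^ 2)"
          using gold_add[of x z 1, unfolded gold_exponents, unfolded power_one_right] .
        moreover have "(x + z) ^ 5 = x ^ 5 + z ^ 5 + (x ^ 4 * z + x * z ^ 4)"
          using gold_add[of x z 2] by simp
        ultimately show ?thesis
          by (simp add: Q_def algebra_simps)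
      qed
      have *: "chi (b * (x ^ 2 * z)) = chi (x ^ 4 * (b ^ 2 * z ^ 2))"
        "chi (b * (x * z ^ 2)) = chi (x ^ 4 * (b ^ 4 * z ^ 8))"
        "chi (c * (x * z ^ 4)) = chi (x ^ 4 * (c ^ 4 * z ^ 16))"
        using chi_frobenius[of "b * (x ^ 2 * z)" 1] chi_frobenius[of "b * (x * z ^ 2)" 2]
          chi_frobenius[of "c * (x * z ^ 4)" 2]
        by (simp_all add: power_mult_distrib mult_ac flip: power_mult)
      have N: "lin 1 e 4 z = c * z + b ^ 2 * z ^ 2 + b ^ 4 * z ^ 8 + c ^ 4 * z ^ 16"
        by (simp add: lin_def e_def numeral_eq_Suc)
      have x4: "x ^ (2 ^ 2) = x ^ 4" by simp
      show ?thesis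
        unfolding Q N x4 chi_add distrib_left[of "x ^ 4"] * by (simp only: mult_ac)
    qed
    have "Q 0 = 0" by (simp add: Q_def)
    thus ?thesis
      using quadratic_character_sum[OF coprime_1_left e0 bij_frobenius _ chi_eq] by (auto simp: S_def)
  qed
  moreover have "S \<in> spectrum" if "S = 0"
    using that by (simp add: spectrum_def)
  ultimately show "wsum (\<lambda>x. x ^ 3) (\<lambda>x. x ^ 5) (a, b, c) \<in> spectrum"
    unfolding wsum using in_spectrum[of S] by fastforce
  assume "n \<ge> 5"
  show "wsum (\<lambda>x. x ^ 3) (\<lambda>x. x ^ 5) (a, b, c) \<noteq> 2 ^ n"
  proof
    assume "wsum (\<lambda>x. x ^ 3) (\<lambda>x. x ^ 5) (a, b, c) = 2 ^ n"
    hence S: "S = 2 ^ n" by (simp add: wsum)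
    then obtain d where "d \<le> 4" "S\<^sup>2 = 2 ^ (n + d)"
      using \<open>S = 0 \<or> (\<exists>d\<le>4. S\<^sup>2 = 2 ^ (n + d))\<close> by auto
    hence "(2::int) ^ (n + n) = 2 ^ (n + d)"
      by (simp add: S power2_eq_square power_add)
    hence "n + n = n + d"
      by (simp only: power_inject_exp one_less_numeral_iff semiring_norm)
    thus False
      using \<open>n \<ge> 5\<close> \<open>d \<le> 4\<close> by simp
  qed
qed

text \<open>Frobenius supplies the even power sums, so those of order 1 to 6 vanish; the Vandermonde
  lemma with \<delta> v = v makes every element of a shorter word zero.\<close>

lemma bch_min_weight:
  assumes "S \<in> fun_code (\<lambda>x::'a. x ^ 3) (\<lambda>x. x ^ 5)" "S \<noteq> {}"
  shows "7 \<le> card S"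
proof (rule ccontr)
  assume "\<not> 7 \<le> card S"
  have p: "(\<Sum>x\<in>S. x) = 0" "(\<Sum>x\<in>S. x ^ 3) = 0" "(\<Sum>x\<in>S. x ^ 5) = 0" "0 \<notin> S"
    using assms(1) by (auto simp: fun_code_def nonzeros_def)
  have even: "(\<Sum>x\<in>S. x ^ 2) = 0" "(\<Sum>x\<in>S. x ^ 4) = 0" "(\<Sum>x\<in>S. x ^ 6) = 0"
    using frobenius_sum[of "\<lambda>x. x" S 1] frobenius_sum[of "\<lambda>x. x" S 2] frobenius_sum[of "\<lambda>x. x ^ 3" S 1] p
    by (simp_all flip: power_mult)
  obtain v where v: "v \<in> S" using assms(2) by blast
  have "(\<Sum>v\<in>S. v * v ^ j) = 0" if "j < card S" for j
  proof -
    have "Suc j \<in> {1, 2, 3, 4, 5, 6}"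
      using that \<open>\<not> 7 \<le> card S\<close> by (simp, linarith)
    moreover have "\<forall>i\<in>{1, 2, 3, 4, 5, 6}. (\<Sum>v\<in>S. v ^ i) = 0"
      using p even by simp
    ultimately show ?thesis
      unfolding power_Suc[symmetric] by (rule bspec[rotated])
  qed
  hence "v = 0"
    using power_sums_eq_0_imp_eq_0[of S "\<lambda>v. v" v] v by simp
  thus False using v p by simp
qed

text \<open>The nonzero vectors of a three-dimensional subspace, on which quadratic maps sum to zero.\<close>
lemma bch_word_of_weight_7:
  assumes "n \<ge> 5"
  obtains S where "S \<in> fun_code (\<lambda>x::'a. x ^ 3) (\<lambda>x. x ^ 5)" "card S = 7"
proof -
  have "(2::nat) ^ 5 \<le> 2 ^ n"
    using assms by (intro power_increasing) auto
  hence card: "card (UNIV :: 'a set) \<ge> 32" by (simp add: card_field)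
  have ex: "\<exists>x. x \<notin> A" if "card A < 32" for A :: "'a set"
    using card that by (metis UNIV_eq_I not_le)
  obtain b :: 'a where b: "b \<notin> {0, 1}" using ex[of "{0, 1}"] by auto
  have "card (set [0, 1, b, 1 + b]) < 32"
    by (rule le_less_trans[OF card_length]) simp
  then obtain c where "c \<notin> set [0, 1, b, 1 + b]"
    using ex by blast
  hence c: "c \<noteq> 0" "c \<noteq> 1" "c \<noteq> b" "c \<noteq> 1 + b" by auto
  have eqs: "1 + x = 1 \<longleftrightarrow> x = 0" "x + y = x \<longleftrightarrow> y = 0" "x + y = y \<longleftrightarrow> x = 0"
    "x = x + y \<longleftrightarrow> y = 0" "y = x + y \<longleftrightarrow> x = 0" "x + y = x + z \<longleftrightarrow> y = z"  for x y z :: 'a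
    by auto
  let ?xs = "[1, b, c, 1 + b, 1 + c, b + c, 1 + (b + c)]"
  have ne: "1 + b \<noteq> c" "b + c \<noteq> 1" "1 + (b + c) \<noteq> 0"
    using c by (auto simp: add_eq_iff_eq_add add.commute)
  have dist: "distinct ?xs" "0 \<notin> set ?xs"
    using b c ne by (auto simp: eqs add_ac dest: sym)
  have sums: "(\<Sum>x\<in>set ?xs. h x) = sum_list (map h ?xs)" for h :: "'a \<Rightarrow> 'a"
    by (rule sum_list_distinct_conv_sum_set[OF dist(1), symmetric])
  have quad: "sum_list (map (\<lambda>x. x ^ (2 ^ m + 1)) ?xs) = 0" for m
    by (simp add: frobenius_add algebra_simps)
  have "set ?xs \<in> fun_code (\<lambda>x::'a. x ^ 3) (\<lambda>x. x ^ 5)"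
    unfolding fun_code_def mem_Collect_eq sums
    using dist(2) quad[of 1, unfolded gold_exponents] quad[of 2, unfolded gold_exponents]
    by (auto simp: nonzeros_def add_ac)
  moreover have "card (set ?xs) = 7"
    using dist(1) by (simp only: distinct_card) simp
  ultimately show thesis ..
qed

text \<open>The code is closed under symmetric difference, as the overlap cancels in characteristic
  2; so distances are weights of nonzero words.\<close>

lemma min_distance_fun_code:
  assumes "S7 \<in> fun_code f g" "card S7 = 7"
    and dist: "\<And>S. S \<in> fun_code f g \<Longrightarrow> S \<noteq> {} \<Longrightarrow> 7 \<le> card S"
  shows "min_distance (fun_code f g :: 'a set set) = 7"
  unfolding min_distance_def
proof (rule Min_eqI)
  let ?D = "{hamming_dist S T | S T. S \<in> fun_code f g \<and> T \<in> fun_code f g \<and> S \<noteq> T}"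
  show "finite ?D"
    by (rule finite_subset[of _ "(\<lambda>(S, T). hamming_dist S T) ` UNIV"]) auto
  have "{} \<in> fun_code f g"
    by (simp add: fun_code_def)
  thus "7 \<in> ?D"
  proof -
    have "hamming_dist S7 {} = 7" "S7 \<noteq> {}"
      using assms(2) by (auto simp: hamming_dist_def)
    thus ?thesis
      using assms(1) \<open>{} \<in> fun_code f g\<close> by (intro CollectI exI[of _ S7] exI[of _ "{}"]) simp
  qed
  fix y assume "y \<in> ?D"
  then obtain S T where ST: "S \<in> fun_code f g" "T \<in> fun_code f g" "S \<noteq> T" "y = hamming_dist S T"
    by blast
  let ?X = "(S - T) \<union> (T - S)"
  have sum: "(\<Sum>x\<in>?X. h x) = (\<Sum>x\<in>S. h x) + (\<Sum>x\<in>T. h x)" for h :: "'a \<Rightarrow> 'a"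
  proof -
    have "(\<Sum>x\<in>?X. h x) = (\<Sum>x\<in>S - T. h x) + (\<Sum>x\<in>T - S. h x)"
      by (rule sum.union_disjoint) auto
    also have "\<dots> = ((\<Sum>x\<in>S - T. h x) + (\<Sum>x\<in>S \<inter> T. h x)) + ((\<Sum>x\<in>T - S. h x) + (\<Sum>x\<in>T \<inter> S. h x))"
      by (simp add: Int_commute add_ac)
    finally show ?thesis
      by (simp add: sum.Int_Diff[of S h T] sum.Int_Diff[of T h S] add.commute)
  qed
  have "?X \<in> fun_code f g"
    using ST(1,2) by (auto simp: fun_code_def sum)
  moreover have "?X \<noteq> {}" using ST(3) by blast
  ultimately show "7 \<le> y"
    using dist ST(4) by (simp add: hamming_dist_def)
qed

end

section \<open>The code with the exponents of f and g\<close>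

locale kasami_welch = odd_binary_field n F for n and F :: "'a::{finite,field} itself" +
  fixes k :: nat
  assumes k_pos: "k > 0" and coprime: "coprime k n"
begin

lemma coprime_2k: "coprime (2 * k) n"
  using coprime odd_n by simp

abbreviation (input) "A \<equiv> (2::nat) ^ (2 * k) - 2 ^ k + 1"
abbreviation (input) "B \<equiv> (2::nat) ^ (4 * k) - 2 ^ (3 * k) + 2 ^ (2 * k) - 2 ^ k + 1"

lemma exponents:
  "(2 ^ k + 1) * A = 2 ^ (3 * k) + 1"
  "(2 ^ k + 1) * B = 2 ^ (5 * k) + 1"
proof -
  define q :: int where "q = 2 ^ k"
  \<comment> \<open>These inequalities make the truncated subtractions in \<open>A\<close> and
    \<open>B\<close> exact, so the claims become polynomial identities in q over the
    integers.\<close>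
  have "(2::nat) ^ k \<le> 2 ^ (2 * k)" "(2::nat) ^ (3 * k) \<le> 2 ^ (4 * k)"
    by (intro power_increasing; simp)+
  moreover have "int (u - v + w - x + 1) = int u - int v + int w - int x + 1"
    if "v \<le> u" "x \<le> w" for u v w x
    using that by linarith
  ultimately have "int A = 2 ^ (2 * k) - 2 ^ k + 1" "int B = 2 ^ (4 * k) - 2 ^ (3 * k) + 2 ^ (2 * k) - 2 ^ k + 1"
    by (simp_all only: of_nat_add of_nat_diff of_nat_power of_nat_numeral of_nat_1)
  hence AB: "int A = q ^ 2 - q + 1" "int B = q ^ 4 - q ^ 3 + q ^ 2 - q + 1"
    by (simp_all add: q_def mult.commute flip: power_mult)
  have "int ((2 ^ k + 1) * A) = (q + 1) * (q ^ 2 - q + 1)"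
    unfolding of_nat_mult AB by (simp add: q_def)
  also have "\<dots> = q ^ 3 + 1" by algebra
  also have "\<dots> = int (2 ^ (3 * k) + 1)" by (simp add: q_def mult.commute flip: power_mult)
  finally show "(2 ^ k + 1) * A = 2 ^ (3 * k) + 1" by (simp only: of_nat_eq_iff)
  have "int ((2 ^ k + 1) * B) = (q + 1) * (q ^ 4 - q ^ 3 + q ^ 2 - q + 1)"
    unfolding of_nat_mult AB by (simp add: q_def)
  also have "\<dots> = q ^ 5 + 1" by algebra
  also have "\<dots> = int (2 ^ (5 * k) + 1)" by (simp add: q_def mult.commute flip: power_mult)
  finally show "(2 ^ k + 1) * B = 2 ^ (5 * k) + 1" by (simp only: of_nat_eq_iff)
qed

definition gold :: "'a \<Rightarrow> 'a" where
  "gold y = y ^ (2 ^ k + 1)"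

lemma gold_power: "gold y ^ A = y ^ (2 ^ (3 * k) + 1)" "gold y ^ B = y ^ (2 ^ (5 * k) + 1)"
  unfolding gold_def power_mult[symmetric] exponents by rule+

text \<open>A quotient r of two preimages satisfies r^q = 1/r with q = 2^k, hence r^(q^2) = r, and r
  = 1 because 2k is coprime to n.\<close>

lemma bij_gold: "bij gold"
proof -
  have "y = z" if "gold y = gold z" for y z
  proof (cases "z = 0")
    case True
    thus ?thesis using that by (simp add: gold_def)
  next
    case False
    define r where "r = y / z"
    have "r ^ (2 ^ k) * r = 1"
      using that False by (simp add: r_def gold_def power_divide mult.commute)
    hence r: "r ^ (2 ^ k) = 1 / r" "r \<noteq> 0"
      by (auto simp: eq_divide_eq)
    have "r ^ (2 ^ (2 * k)) = (r ^ (2 ^ k)) ^ (2 ^ k)"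
      by (simp add: power_frobenius mult_2)
    also have "\<dots> = r"
      by (simp add: r power_divide)
    finally have "r = 1"
      using frobenius_fixed[OF coprime_2k] r(2) by blast
    thus ?thesis using False by (simp add: r_def)
  qed
  hence "inj gold" by (rule injI)
  thus ?thesis by (simp add: bij_def finite_UNIV_inj_surj)
qed

text \<open>After the substitution, powers of Frobenius bring each polar term to a multiple of
  x^(q^5), q = 2^k. Then z occurs only as z^(q^j) with j even, so the degree is 5 in steps of
  2k.\<close>

lemma kasami_welch_sum_in_spectrum:
  assumes "(a, b, c) \<noteq> (0, 0, 0)"
  shows "wsum (\<lambda>x. x ^ A) (\<lambda>x. x ^ B) (a, b, c) \<in> spectrum"
proof -
  define Q where "Q y = a * y ^ (2 ^ k + 1) + b * y ^ (2 ^ (3 * k) + 1) + c * y ^ (2 ^ (5 * k) + 1)" for y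
  define S where "S = (\<Sum>y\<in>UNIV. chi (Q y))"
  have "wsum (\<lambda>x. x ^ A) (\<lambda>x. x ^ B) (a, b, c) =
      (\<Sum>y\<in>UNIV. chi (a * gold y + b * gold y ^ A + c * gold y ^ B))"
    unfolding wsum_def phase_def fst_conv snd_conv by (rule sum.reindex_bij_betw[OF bij_gold, symmetric])
  also have "\<dots> = S"
    unfolding gold_power by (simp only: S_def Q_def gold_def)
  finally have wsum: "wsum (\<lambda>x. x ^ A) (\<lambda>x. x ^ B) (a, b, c) = S" .
  \<comment> \<open>The coefficients of z^(q^j) for j = 0, 2, 4, 6, 8, 10; the first three already
    contain powers of c, b and a.\<close>
  define e where "e i = [c, b ^ (2 ^ (2 * k)), a ^ (2 ^ (4 * k)), a ^ (2 ^ (5 * k)), b ^ (2 ^ (5 * k)), c ^ (2 ^ (5 * k))] ! i" for i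
  have e0: "\<exists>i\<le>5. e i \<noteq> 0"
  proof -
    have "\<exists>i\<in>{0, 1, 2}. e i \<noteq> 0"
      using assms by (auto simp: e_def)
    thus ?thesis by (auto intro: exI[of _ 0] exI[of _ 1] exI[of _ 2])
  qed
  have chi_eq: "chi (Q (x + z)) = chi (Q x) * chi (Q z) * chi (x ^ (2 ^ (5 * k)) * lin (2 * k) e 5 z)" for x z
  proof -
    let ?p = "\<lambda>(x::'a) j. x ^ (2 ^ (j * k))"
    have Q: "Q (x + z) = Q x + Q z + (a * (?p x 1 * z) + a * (x * ?p z 1) +
        (b * (?p x 3 * z) + b * (x * ?p z 3)) + (c * (?p x 5 * z) + c * (x * ?p z 5)))"
      unfolding Q_def gold_add by (simp add: algebra_simps)
    have p: "?p (?p y i) j = ?p y (i + j)" for y i j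
      by (simp add: power_frobenius distrib_right)
    have p_mult: "?p (y * w) j = ?p y j * ?p w j" for y w j
      by (rule power_mult_distrib)
    have chi_p: "chi (?p y j) = chi y" for y j
      by (rule chi_frobenius)
    have *: "chi (a * (?p x 1 * z)) = chi (?p x 5 * (?p a 4 * ?p z 4))"
      "chi (a * (x * ?p z 1)) = chi (?p x 5 * (?p a 5 * ?p z 6))"
      "chi (b * (?p x 3 * z)) = chi (?p x 5 * (?p b 2 * ?p z 2))"
      "chi (b * (x * ?p z 3)) = chi (?p x 5 * (?p b 5 * ?p z 8))"
      "chi (c * (?p x 5 * z)) = chi (?p x 5 * (c * z))"
      "chi (c * (x * ?p z 5)) = chi (?p x 5 * (?p c 5 * ?p z 10))"
      using chi_p[of "a * (?p x 1 * z)" 4] chi_p[of "a * (x * ?p z 1)" 5]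
        chi_p[of "b * (?p x 3 * z)" 2] chi_p[of "b * (x * ?p z 3)" 5] chi_p[of "c * (x * ?p z 5)" 5]
      unfolding p_mult p by (simp_all add: mult_ac)
    have N: "lin (2 * k) e 5 z = c * z + ?p b 2 * ?p z 2 + ?p a 4 * ?p z 4 + ?p a 5 * ?p z 6 +
        ?p b 5 * ?p z 8 + ?p c 5 * ?p z 10"
    proof -
      have "lin (2 * k) e 5 z = (\<Sum>i\<in>{0, 1, 2, 3, 4, 5}. e i * ?p z (2 * i))"
        unfolding lin_def by (intro sum.cong) (auto simp: mult_ac)
      also have "\<dots> = c * z + ?p b 2 * ?p z 2 + ?p a 4 * ?p z 4 + ?p a 5 * ?p z 6 +
          ?p b 5 * ?p z 8 + ?p c 5 * ?p z 10"
        by (simp add: e_def add_ac mult_2)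
      finally show ?thesis .
    qed
    show ?thesis
      unfolding Q N chi_add distrib_left[of "?p x 5"] * by (simp only: mult_ac)
  qed
  have "Q 0 = 0" by (simp add: Q_def)
  hence "S = 0 \<or> (\<exists>d\<le>5. S\<^sup>2 = 2 ^ (n + d))"
    using quadratic_character_sum[OF coprime_2k e0 bij_frobenius _ chi_eq] by (auto simp: S_def)
  moreover have "S \<in> spectrum" if "S = 0"
    using that by (simp add: spectrum_def)
  ultimately show ?thesis
    unfolding wsum using in_spectrum[of S] by blast
qed

text \<open>Pulling the word back along \<open>gold\<close> turns its checks into those of
  \<open>no_short_word\<close> with steps of 2k.\<close>

lemma kasami_welch_min_weight:
  assumes "S \<in> fun_code (\<lambda>x::'a. x ^ A) (\<lambda>x. x ^ B)" "S \<noteq> {}"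
  shows "7 \<le> card S"
proof (rule ccontr)
  assume short: "\<not> 7 \<le> card S"
  define S' where "S' = gold -` S"
  have bij: "bij_betw gold S' S"
    using bij_gold by (simp add: S'_def bij_betw_def bij_def inj_on_subset[of _ UNIV])
  have "0 \<notin> S"
    using assms(1) by (auto simp: fun_code_def nonzeros_def)
  hence "0 \<notin> S'" by (simp add: S'_def gold_def)
  moreover have "card S' = card S"
    using bij by (rule bij_betw_same_card)
  moreover have "S' \<noteq> {}"
    using bij assms(2) by (auto simp: bij_betw_def)
  moreover have "(\<Sum>x\<in>S'. x ^ (2 ^ (5 * k)) * x ^ (2 ^ (2 * k * i))) = 0" if "i \<le> 5" for i
  proof -
    have "(\<Sum>y\<in>S'. gold y) = 0" "(\<Sum>y\<in>S'. gold y ^ A) = 0" "(\<Sum>y\<in>S'. gold y ^ B) = 0"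
      using assms(1) sum.reindex_bij_betw[OF bij, of "\<lambda>x. x"] sum.reindex_bij_betw[OF bij, of "\<lambda>x. x ^ A"]
        sum.reindex_bij_betw[OF bij, of "\<lambda>x. x ^ B"] by (auto simp: fun_code_def)
    hence zero: "(\<Sum>y\<in>S'. y ^ (2 ^ (j * k) + 1)) = 0" if "j \<in> {1, 3, 5}" for j
      using that unfolding gold_power unfolding gold_def by auto
    have shift: "(\<Sum>y\<in>S'. y ^ (2 ^ ((l + j) * k)) * y ^ (2 ^ (l * k))) = 0" if "j \<in> {1, 3, 5}" for j l
    proof -
      have "(\<Sum>y\<in>S'. y ^ (2 ^ ((l + j) * k)) * y ^ (2 ^ (l * k))) =
          (\<Sum>y\<in>S'. (y ^ (2 ^ (j * k) + 1)) ^ (2 ^ (l * k)))"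
        by (simp add: power_mult_distrib power_add power_mult power_frobenius distrib_right)
          (simp add: mult_ac flip: power_mult power_add)
      also have "\<dots> = 0"
        unfolding frobenius_sum[symmetric] zero[OF that] by simp
      finally show ?thesis .
    qed
    have "i \<in> {0, 1, 2, 3, 4, 5}"
      using that by (simp, linarith)
    thus ?thesis
      \<comment> \<open>The exponents 5 and 2i of q differ by 5, 3, 1, 1, 3, 5 for i = 0 to 5, so
        each sum is a Frobenius power of a given check.\<close>
      using shift[of 5 0] shift[of 3 2] shift[of 1 4] shift[of 1 5] shift[of 3 5] shift[of 5 5]
      by (auto simp: mult_ac)
  qed
  ultimately show False
    using no_short_word[OF coprime_2k, of S' "5 * k"] k_pos short by simp
qed

end

section \<open>Parameters and weight distribution\<close>

theorem theorem2:
  fixes n k :: nat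
  assumes "odd n" and "n \<ge> 5" and "k > 0" and "coprime k n"
    and "card (UNIV :: 'a::{finite,field} set) = 2 ^ n"
  defines "C \<equiv> (power_code (2^(2*k) - 2^k + 1)
                  (2^(4*k) - 2^(3*k) + 2^(2*k) - 2^k + 1) :: 'a set set)"
  shows "code_length C = 2 ^ n - 1
         \<and> card C = 2 ^ (2 ^ n - 3 * n - 1)
         \<and> binary_dim C = 2 ^ n - 3 * n - 1
         \<and> min_distance C = 7
         \<and> weight_distribution C = weight_distribution (bch3_code :: 'a set set)"
proof -
  interpret kasami_welch n "TYPE('a)" k
    by unfold_locales (use assms in auto)
  let ?f = "\<lambda>x::'a. x ^ A" and ?g = "\<lambda>x::'a. x ^ B"
  let ?f' = "\<lambda>x::'a. x ^ 3" and ?g' = "\<lambda>x::'a. x ^ 5"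
  have C: "C = fun_code ?f ?g"
    by (simp add: C_def power_code_eq_fun_code)
  have zero: "?f 0 = 0" "?g 0 = 0" "?f' 0 = 0" "?g' 0 = 0"
    by simp_all
  have spec: "wsum ?f ?g t \<in> spectrum" "wsum ?f' ?g' t \<in> spectrum"
    if "t \<noteq> (0, 0, 0)" for t
    using that kasami_welch_sum_in_spectrum bch_sum_in_spectrum(1) by (cases t; blast)+
  have "finite spectrum"
    by (simp add: spectrum_def)
  hence distr: "card {t. wsum ?f ?g t = v} = card {t. wsum ?f' ?g' t = v}" for v
    using wsum_distribution_eq[OF zero kasami_welch_min_weight bch_min_weight _ card_spectrum spec] by blast
  hence wd: "weight_distribution C = weight_distribution (fun_code ?f' ?g')"
    unfolding C using zero by (intro weight_distribution_eqI)
  \<comment> \<open>Triviality of the radical condition is settled for the BCH code, whose degree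
    bound 4 is below n, and transferred by \<open>distr\<close>.\<close>
  have "{t. wsum ?f' ?g' t = 2 ^ n} = {(0, 0, 0)}"
    using wsum_0 bch_sum_in_spectrum(2) \<open>n \<ge> 5\<close> by (auto, blast+)
  hence "card {t. wsum ?f' ?g' t = 2 ^ n} = 1"
    by simp
  hence "card {t. wsum ?f ?g t = 2 ^ n} = 1"
    by (simp only: distr)
  hence card: "2 ^ (3 * n) * card C = 2 ^ (2 ^ n - 1)"
    using card_fun_code[of ?f ?g] by (simp add: C)
  \<comment> \<open>Positivity yields 3n <= 2^n - 1, so the truncated exponent in the dimension is
    exact.\<close>
  hence "card C > 0"
    by (metis gr0I mult_0_right power_not_zero zero_neq_numeral)
  hence "(2::nat) ^ (3 * n) * 1 \<le> 2 ^ (3 * n) * card C"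
    by (intro mult_left_mono) simp_all
  hence "(2::nat) ^ (3 * n) \<le> 2 ^ (2 ^ n - 1)"
    by (simp add: card)
  hence "3 * n \<le> 2 ^ n - 1"
    by (simp only: power_increasing_iff one_less_numeral_iff semiring_norm)
  hence "2 ^ (3 * n) * card C = 2 ^ (3 * n) * 2 ^ (2 ^ n - 3 * n - 1)"
    unfolding card power_add[symmetric] by simp
  hence card_C: "card C = 2 ^ (2 ^ n - 3 * n - 1)"
    by simp
  \<comment> \<open>The equal weight distributions carry the existence of a word of weight 7 over
    from the BCH code.\<close>
  obtain S where "S \<in> fun_code ?f' ?g'" "card S = 7"
    using bch_word_of_weight_7[OF \<open>n \<ge> 5\<close>] .
  hence "weight_distribution C 7 > 0"
    unfolding wd weight_distribution_def by (auto simp: card_gt_0_iff)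
  then obtain S7 where "S7 \<in> C" "card S7 = 7"
    unfolding weight_distribution_def by (auto simp: card_gt_0_iff)
  hence "min_distance C = 7"
    unfolding C using min_distance_fun_code kasami_welch_min_weight by blast
  moreover have "code_length C = 2 ^ n - 1"
    by (simp add: code_length_def nonzeros_def Compl_eq_Diff_UNIV card_field)
  moreover have "binary_dim C = 2 ^ n - 3 * n - 1"
    unfolding binary_dim_def card_C by (rule the_equality) (simp_all add: power_inject_exp)
  ultimately show ?thesis
    using card_C wd by (simp add: bch3_code_def power_code_eq_fun_code)
qed

end
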